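(* Let $(\mathcal{L},\Delta,S)$ be a locality (for a prime $p$) over $\mathcal{F}$ and let $Q\leq S$ be a large subgroup of $\mathcal{L}$. Then the following hold. (a) $Q$ is weakly closed in $\mathcal{L}$. In particular, $Q\unlhd S$, the triple $(N_{\mathcal{L}}(Q),\Delta,S)$ is a locality over $N_{\mathcal{F}}(Q)$, and $O_p(N_{\mathcal{L}}(Q))$ is well-defined. (b) $O_p(N_{\mathcal{L}}(Q))$ is large in $(\mathcal{L},\Delta,S)$. (c) If $R\leq S$ is large in $\mathcal{L}$, then $QR$ is large in $\mathcal{L}$.
   Context: Partial groups. For a set $\mathcal{L}$ let $\mathbf{W}(\mathcal{L})$ be the set of finite words in $\mathcal{L}$, $\emptyset$ the empty word, $\circ$ concatenation; elements are identified with words of length one. A partial group is a non-empty set $\mathcal{L}$ with a set $\mathbf{D}\subseteq\mathbf{W}(\mathcal{L})$, a map $\Pi\colon\mathbf{D}\to\mathcal{L}$ and an involutory bijection $f\mapsto f^{-1}$ on $\mathcal{L}$, extended to words by $(g_1,\dots,g_k)^{-1}=(g_k^{-1},\dots,g_1^{-1})$, such that for all words $u,v,w$: $\mathcal{L}\subseteq\mathbf{D}$, and $u\circ v\in\mathbf{D}$ implies $u,v\in\mathbf{D}$; $\Pi$ is the identity on $\mathcal{L}$; $u\circ v\circ w\in\mathbf{D}$ implies $u\circ(\Pi(v))\circ w\in\mathbf{D}$ and $\Pi(u\circ v\circ w)=\Pi(u\circ(\Pi(v))\circ w)$; $w\in\mathbf{D}$ implies $w^{-1}\circ w\in\mathbf{D}$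 and $\Pi(w^{-1}\circ w)=\mathbf{1}:=\Pi(\emptyset)$. For $f\in\mathcal{L}$ put $\mathbf{D}(f)=\{x\in\mathcal{L}:(f^{-1},x,f)\in\mathbf{D}\}$ and $x^f=\Pi(f^{-1},x,f)$ for $x\in\mathbf{D}(f)$; $X^f=\{x^f:x\in X\}$ for $X\subseteq\mathbf{D}(f)$. A partial subgroup of $\mathcal{L}$ is a subset $\mathcal{H}$ closed under inversion with $\Pi(v)\in\mathcal{H}$ for all $v\in\mathbf{W}(\mathcal{H})\cap\mathbf{D}$; it is itself a partial group with product $\Pi|_{\mathbf{W}(\mathcal{H})\cap\mathbf{D}}$. It is a subgroup if $\mathbf{W}(\mathcal{H})\subseteq\mathbf{D}$ (it is then a group); a $p$-subgroup is a subgroup of $p$-power order. Localities. A locality (for a prime $p$) is a triple $(\mathcal{L},\Delta,S)$ with $\mathcal{L}$ a finite partial group, $S$ a $p$-subgroup of $\mathcal{L}$, $\Delta$ a non-empty set of subgroups of $S$, such that: (L1) $S$ is maximal among the $p$-subgroups of $\mathcal{L}$; (L2) $(f_1,\dots,f_n)\in\mathbf{D}$ iff there are $P_0,\dots,P_n\in\Delta$ with $P_{i-1}\subseteq\mathbf{D}(f_i)$ and $P_{i-1}^{f_i}=P_i$ for all $i$; (L3) $\Delta$ is closed under passing to $\mathcal{L}$-conjugates in $S$ and overgroups in $S$. For $g\in\mathcal{L}$, $S_g=\{x\in S: x\in\mathbf{D}(g),\ x^g\in S\}$; for a word $w=(g_1,\dots,g_n)$, $S_w$ is the set of $x\in S$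 for which there are $x=x_0,x_1,\dots,x_n\in S$ with $x_{i-1}\in\mathbf{D}(g_i)$ and $x_{i-1}^{g_i}=x_i$ for all $i$. For $X\subseteq\mathcal{L}$, $N_{\mathcal{L}}(X)=\{f\in\mathcal{L}:X\subseteq\mathbf{D}(f),\ X^f=X\}$ and $C_{\mathcal{L}}(X)=\{f\in\mathcal{L}:X\subseteq\mathbf{D}(f),\ x^f=x\ \forall x\in X\}$. $N_{\mathcal{L}}(R)$ is a partial subgroup for each $R\leq S$. For any locality, $O_p(\mathcal{L}):=\bigcap_{w\in\mathbf{W}(\mathcal{L})}S_w$, equivalently the largest $P\leq S$ with $\mathcal{L}=N_{\mathcal{L}}(P)$. $\mathcal{F}_S(\mathcal{L})$ is the fusion system over $S$ generated by the conjugation maps $c_g\colon S_g\to S$, $g\in\mathcal{L}$; $(\mathcal{L},\Delta,S)$ is a locality over $\mathcal{F}$ if $\mathcal{F}=\mathcal{F}_S(\mathcal{L})$. $N_{\mathcal{F}}(P)$, for $P\leq S$, is the fusion system over $N_S(P)$ whose morphisms are the $\mathcal{F}$-morphisms $\phi\colon X\to Y$ ($X,Y\leq N_S(P)$) extending to some $\hat\phi\in\mathrm{Hom}_{\mathcal{F}}(XP,YP)$ with $P\hat\phi=P$. $Q\leq S$ is large in $\mathcal{L}$ (or in $(\mathcal{L},\Delta,S)$) if $C_{\mathcal{L}}(Q)\subseteq Q$ and $N_{\mathcal{L}}(U)\subseteq N_{\mathcal{L}}(Q)$ for all $1\neq U\leq Z(Q)$. $Q$ is weakly closed in $\mathcal{L}$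 if $Q^f=Q$ for every $f\in\mathcal{L}$ with $Q\leq S_f$. *)

theory Defs
  imports "HOL-Algebra.Group_Action" "HOL-Computational_Algebra.Primes"
begin

section \<open>Partial groups\<close>

text \<open>Words are lists.  The product and the inversion are total HOL functions; their values
  outside \<open>Dom L\<close> and \<open>elts L\<close>, respectively, carry no meaning.\<close>

record 'a pgroup =
  elts :: "'a set"
  Dom :: "'a list set"
  pprod :: "'a list \<Rightarrow> 'a"
  pinv :: "'a \<Rightarrow> 'a"

definition winv :: "'a pgroup \<Rightarrow> 'a list \<Rightarrow> 'a list"
  where "winv L w = rev (map (pinv L) w)"

definition pone :: "'a pgroup \<Rightarrow> 'a"
  where "pone L = pprod L []"

locale partial_group =
  fixes L :: "'a pgroup"
  assumes nonempty: "elts L \<noteq> {}"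
    and Dom_words: "Dom L \<subseteq> lists (elts L)"
    and prod_closed: "w \<in> Dom L \<Longrightarrow> pprod L w \<in> elts L"
    and inv_closed: "f \<in> elts L \<Longrightarrow> pinv L f \<in> elts L"
    and inv_inv: "f \<in> elts L \<Longrightarrow> pinv L (pinv L f) = f"
    and singleton_Dom: "f \<in> elts L \<Longrightarrow> [f] \<in> Dom L"
    and Dom_split: "u @ v \<in> Dom L \<Longrightarrow> u \<in> Dom L \<and> v \<in> Dom L"
    and prod_singleton: "f \<in> elts L \<Longrightarrow> pprod L [f] = f"
    and prod_assoc: "u @ v @ w \<in> Dom L \<Longrightarrow>
      u @ [pprod L v] @ w \<in> Dom L \<and> pprod L (u @ v @ w) = pprod L (u @ [pprod L v] @ w)"
    and inv_word: "w \<in> Dom L \<Longrightarrow> winv L w @ w \<in> Dom L \<and> pprod L (winv L w @ w) = pone L"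

definition conj_dom :: "'a pgroup \<Rightarrow> 'a \<Rightarrow> 'a set"
  where "conj_dom L f = {x \<in> elts L. [pinv L f, x, f] \<in> Dom L}"

definition conjg :: "'a pgroup \<Rightarrow> 'a \<Rightarrow> 'a \<Rightarrow> 'a"
  \<comment> \<open>\<open>conjg L f x\<close> is \<open>x\<^sup>f\<close>, so \<open>conjg L f ` X\<close> is \<open>X\<^sup>f\<close>\<close>
  where "conjg L f x = pprod L [pinv L f, x, f]"

definition partial_subgroup :: "'a pgroup \<Rightarrow> 'a set \<Rightarrow> bool"
  where "partial_subgroup L H \<longleftrightarrow> H \<subseteq> elts L \<and> (\<forall>h\<in>H. pinv L h \<in> H) \<and>
    (\<forall>v \<in> lists H \<inter> Dom L. pprod L v \<in> H)"

definition sub_pgroup :: "'a pgroup \<Rightarrow> 'a set \<Rightarrow> 'a pgroup"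
  where "sub_pgroup L H =
    \<lparr>elts = H, Dom = lists H \<inter> Dom L, pprod = pprod L, pinv = pinv L\<rparr>"

definition pg_subgroup :: "'a pgroup \<Rightarrow> 'a set \<Rightarrow> bool"
  where "pg_subgroup L H \<longleftrightarrow> partial_subgroup L H \<and> lists H \<subseteq> Dom L"

definition p_subgroup :: "nat \<Rightarrow> 'a pgroup \<Rightarrow> 'a set \<Rightarrow> bool"
  where "p_subgroup p L H \<longleftrightarrow> pg_subgroup L H \<and> finite H \<and> (\<exists>n. card H = p ^ n)"

text \<open>A subgroup of a partial group, viewed as a group.  Subgroups of \<open>S\<close>, normality in \<open>S\<close> and
  products of subgroups of \<open>S\<close> are taken in \<open>grp L S\<close>.\<close>

definition grp :: "'a pgroup \<Rightarrow> 'a set \<Rightarrow> 'a monoid"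
  where "grp L S = \<lparr>carrier = S, monoid.mult = (\<lambda>x y. pprod L [x, y]), one = pone L\<rparr>"

definition pnormalizer :: "'a pgroup \<Rightarrow> 'a set \<Rightarrow> 'a set"
  where "pnormalizer L X = {f \<in> elts L. X \<subseteq> conj_dom L f \<and> conjg L f ` X = X}"

definition pnormalizer_pgroup :: "'a pgroup \<Rightarrow> 'a set \<Rightarrow> 'a pgroup"
  where "pnormalizer_pgroup L X = sub_pgroup L (pnormalizer L X)"

definition pcentralizer :: "'a pgroup \<Rightarrow> 'a set \<Rightarrow> 'a set"
  where "pcentralizer L X = {f \<in> elts L. X \<subseteq> conj_dom L f \<and> (\<forall>x\<in>X. conjg L f x = x)}"


section \<open>Fusion systems\<close>

text \<open>A fusion system over a group \<open>G\<close> is given by its morphism sets: \<open>F P R\<close> is the set of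
  morphisms from \<open>P\<close> to \<open>R\<close>, each represented by a function that is \<open>undefined\<close> outside \<open>P\<close>.
  The objects are the subgroups of \<open>G\<close>; the morphism sets for all other pairs of sets are required
  to be empty, so that equal fusion systems are equal as functions.\<close>

type_synonym 'a homsets = "'a set \<Rightarrow> 'a set \<Rightarrow> ('a \<Rightarrow> 'a) set"

definition inj_homs :: "'a monoid \<Rightarrow> 'a homsets"
  where "inj_homs G P R = {\<phi> \<in> extensional P. subgroup P G \<and> subgroup R G \<and>
    \<phi> \<in> hom (G\<lparr>carrier := P\<rparr>) (G\<lparr>carrier := R\<rparr>) \<and> inj_on \<phi> P}"

definition conj_homs :: "'a monoid \<Rightarrow> 'a homsets"
  where "conj_homs G P R = {\<phi> \<in> inj_homs G P R.
    \<exists>s \<in> carrier G. \<phi> = restrict (\<lambda>x. inv\<^bsub>G\<^esub> s \<otimes>\<^bsub>G\<^esub> x \<otimes>\<^bsub>G\<^esub> s) P}"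

text \<open>The assumption \<open>factor\<close> says that every morphism is an isomorphism of the fusion system
  followed by an inclusion; the isomorphism is then necessarily onto the image.  Identities and
  inclusions belong to \<open>conj_homs G\<close>.\<close>

locale fusion_system =
  fixes G :: "'a monoid" and F :: "'a homsets"
  assumes inj: "F P R \<subseteq> inj_homs G P R"
    and conj: "conj_homs G P R \<subseteq> F P R"
    and comp: "\<phi> \<in> F P R \<Longrightarrow> \<psi> \<in> F R T \<Longrightarrow> compose P \<psi> \<phi> \<in> F P T"
    and factor: "\<phi> \<in> F P R \<Longrightarrow>
      \<phi> \<in> F P (\<phi> ` P) \<and> restrict (inv_into P \<phi>) (\<phi> ` P) \<in> F (\<phi> ` P) P"

definition generated_fusion_system ::
    "'a monoid \<Rightarrow> ('a set \<times> 'a set \<times> ('a \<Rightarrow> 'a)) set \<Rightarrow> 'a homsets"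
  where "generated_fusion_system G M P R =
    \<Inter> {F P R | F. fusion_system G F \<and> (\<forall>(X, Y, \<phi>) \<in> M. \<phi> \<in> F X Y)}"

definition normalizer_fusion_system :: "'a monoid \<Rightarrow> 'a homsets \<Rightarrow> 'a set \<Rightarrow> 'a homsets"
  where "normalizer_fusion_system G F P X Y = {\<phi> \<in> F X Y.
    subgroup X (G\<lparr>carrier := normalizer G P\<rparr>) \<and> subgroup Y (G\<lparr>carrier := normalizer G P\<rparr>) \<and>
    (\<exists>\<phi>' \<in> F (X <#>\<^bsub>G\<^esub> P) (Y <#>\<^bsub>G\<^esub> P). (\<forall>x\<in>X. \<phi>' x = \<phi> x) \<and> \<phi>' ` P = P)}"


section \<open>Localities\<close>

locale locality = partial_group L for L :: "'a pgroup" +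
  fixes p :: nat and \<Delta> :: "'a set set" and S :: "'a set"
  assumes prime_p: "prime p"
    and finite_elts: "finite (elts L)"
    and S_p_subgroup: "p_subgroup p L S"
    and Delta_nonempty: "\<Delta> \<noteq> {}"
    and Delta_subgroups: "P \<in> \<Delta> \<Longrightarrow> subgroup P (grp L S)"
    and L1: "p_subgroup p L T \<Longrightarrow> S \<subseteq> T \<Longrightarrow> T = S"
    and L2: "w \<in> lists (elts L) \<Longrightarrow> w \<in> Dom L \<longleftrightarrow>
      (\<exists>P :: nat \<Rightarrow> 'a set. (\<forall>i\<le>length w. P i \<in> \<Delta>) \<and>
        (\<forall>i<length w. P i \<subseteq> conj_dom L (w ! i) \<and> conjg L (w ! i) ` P i = P (Suc i)))"
    and L3_conj: "P \<in> \<Delta> \<Longrightarrow> f \<in> elts L \<Longrightarrow> P \<subseteq> conj_dom L f \<Longrightarrow>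
      subgroup (conjg L f ` P) (grp L S) \<Longrightarrow> conjg L f ` P \<in> \<Delta>"
    and L3_over: "P \<in> \<Delta> \<Longrightarrow> subgroup R (grp L S) \<Longrightarrow> P \<subseteq> R \<Longrightarrow> R \<in> \<Delta>"

definition S_elt :: "'a pgroup \<Rightarrow> 'a set \<Rightarrow> 'a \<Rightarrow> 'a set"
  \<comment> \<open>\<open>S\<^sub>g\<close>\<close>
  where "S_elt L S g = {x \<in> S. x \<in> conj_dom L g \<and> conjg L g x \<in> S}"

definition S_word :: "'a pgroup \<Rightarrow> 'a set \<Rightarrow> 'a list \<Rightarrow> 'a set"
  \<comment> \<open>\<open>S\<^sub>w\<close>\<close>
  where "S_word L S w = {x \<in> S. \<exists>y :: nat \<Rightarrow> 'a. y 0 = x \<and> (\<forall>i\<le>length w. y i \<in> S) \<and>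
    (\<forall>i<length w. y i \<in> conj_dom L (w ! i) \<and> conjg L (w ! i) (y i) = y (Suc i))}"

definition O_p :: "'a pgroup \<Rightarrow> 'a set \<Rightarrow> 'a set"
  \<comment> \<open>The prime is determined by \<open>S\<close>.\<close>
  where "O_p L S = (\<Inter>w \<in> lists (elts L). S_word L S w)"

definition largest_normal :: "'a pgroup \<Rightarrow> 'a set \<Rightarrow> 'a set \<Rightarrow> bool"
  \<comment> \<open>\<open>P\<close> is the largest subgroup of \<open>S\<close> whose normalizer is all of \<open>L\<close>\<close>
  where "largest_normal L S P \<longleftrightarrow> subgroup P (grp L S) \<and> pnormalizer L P = elts L \<and>
    (\<forall>R. subgroup R (grp L S) \<and> pnormalizer L R = elts L \<longrightarrow> R \<subseteq> P)"

definition fusion_system_of :: "'a pgroup \<Rightarrow> 'a set \<Rightarrow> 'a homsets"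
  where "fusion_system_of L S = generated_fusion_system (grp L S)
    {(S_elt L S g, S, restrict (conjg L g) (S_elt L S g)) | g. g \<in> elts L}"

definition locality_over ::
    "nat \<Rightarrow> 'a pgroup \<Rightarrow> 'a set set \<Rightarrow> 'a set \<Rightarrow> 'a homsets \<Rightarrow> bool"
  where "locality_over p L \<Delta> S F \<longleftrightarrow> locality L p \<Delta> S \<and> F = fusion_system_of L S"

definition group_center :: "'a pgroup \<Rightarrow> 'a set \<Rightarrow> 'a set"
  where "group_center L Q = {z \<in> Q. \<forall>x\<in>Q. pprod L [z, x] = pprod L [x, z]}"

definition large :: "'a pgroup \<Rightarrow> 'a set \<Rightarrow> 'a set \<Rightarrow> bool"
  where "large L S Q \<longleftrightarrow> subgroup Q (grp L S) \<and> pcentralizer L Q \<subseteq> Q \<and>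
    (\<forall>U. subgroup U (grp L (group_center L Q)) \<and> U \<noteq> {pone L} \<longrightarrow>
      pnormalizer L U \<subseteq> pnormalizer L Q)"

definition weakly_closed :: "'a pgroup \<Rightarrow> 'a set \<Rightarrow> 'a set \<Rightarrow> bool"
  where "weakly_closed L S Q \<longleftrightarrow> (\<forall>f \<in> elts L. Q \<subseteq> S_elt L S f \<longrightarrow> conjg L f ` Q = Q)"

end

theory Submission
  imports Defs "HOL-Algebra.Sylow" "HOL-Algebra.SndIsomorphismGrp"
begin

text \<open>The centre \<open>Z\<close> of \<open>S\<close> centralizes \<open>Q\<close>, so it lies in \<open>Z(Q)\<close>, and \<open>S\<close> normalizes
  \<open>Q\<close> because it normalizes \<open>Z\<close>.  If \<open>Q\<^sup>f\<close> lies in \<open>S\<close>, then \<open>Z\<close> also lies in the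
  centre of \<open>Q\<^sup>f\<close>, so whatever centralizes \<open>Z\<close> normalizes both \<open>Q\<close> and \<open>Q\<^sup>f\<close> wherever
  this makes sense; weak closure then follows from Sylow's theorem by induction on \<open>S\<^sub>f\<close>.
  Morphisms of the fusion system are restrictions of conjugations by words, and by weak closure
  a word \<open>w\<close> with \<open>Q \<le> S\<^sub>w\<close> has all its letters in \<open>N\<^sub>L(Q)\<close>.  An overgroup of a
  large subgroup in \<open>S\<close> has a smaller centre and a smaller centralizer, which reduces (b) and
  (c) to comparing normalizers.\<close>

section \<open>Finite \<open>p\<close>-groups\<close>

text \<open>Products and conjugates exist only along chains of objects, so ordinary group theory is
  available only in suitable places: for \<open>P \<in> \<Delta>\<close> the set
  \<open>pnormalizer L P\<close> is a finite group, and an element taking \<open>P\<close> to an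
  object \<open>R\<close> induces an isomorphism from it to the normalizer of \<open>R\<close>.
  Since \<open>Q\<close> need not be an object, its normalizer is handled only as a partial
  subgroup, and the Sylow arguments run inside normalizers of objects. Maximality of
  \<open>S\<close> among the p-subgroups does not by itself give a Sylow theorem for
  \<open>L\<close>. Conjugation into \<open>S\<close> is obtained by a separate induction, and only
  for p-subgroups between an object and its normalizer. In the proof of weak closure the image of
  \<open>Q\<close> under \<open>f\<close> is not known to be large, which would be a consequence of
  the claim. Therefore the centre of \<open>S\<close> is pulled back along \<open>f\<close> into the
  centre of \<open>Q\<close>, where largeness of \<open>Q\<close> applies. Largeness speaks only
  about nontrivial subgroups of the centre of \<open>Q\<close>; hence a trivial \<open>S\<close> is
  a separate case.\<close>

lemma (in group) p_group_fixed_point_free_dvd: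
  assumes "prime p" and "order G = p ^ n" and "finite E"
    and closed: "\<And>g x. g \<in> carrier G \<Longrightarrow> x \<in> E \<Longrightarrow> act g x \<in> E"
    and one: "\<And>x. x \<in> E \<Longrightarrow> act \<one> x = x"
    and mult: "\<And>g h x. g \<in> carrier G \<Longrightarrow> h \<in> carrier G \<Longrightarrow> x \<in> E \<Longrightarrow> act (g \<otimes> h) x = act g (act h x)"
    and moved: "\<And>x. x \<in> E \<Longrightarrow> \<exists>g \<in> carrier G. act g x \<noteq> x"
  shows "p dvd card E"
proof -
  \<comment> \<open>The library's actions take values in \<open>Bij E\<close>, whose members are
    extensional, hence the restriction.\<close>
  let ?\<phi> = "\<lambda>g. restrict (act g) E"
  have inv_act: "act (inv g) (act g x) = x" "act g (act (inv g) x) = x" if "g \<in> carrier G" "x \<in> E" for g x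
    using that mult[of "inv g" g x] mult[of g "inv g" x] one by (simp_all add: l_inv r_inv)
  have bij: "?\<phi> g \<in> Bij E" if "g \<in> carrier G" for g
  proof -
    have "bij_betw (act g) E E"
      using that inv_act closed by (intro bij_betw_byWitness[where f' = "act (inv g)"]) auto
    then show ?thesis
      by (simp add: Bij_def bij_betw_restrict_eq)
  qed
  have "?\<phi> \<in> hom G (BijGroup E)"
  proof (rule homI)
    fix g h assume gh: "g \<in> carrier G" "h \<in> carrier G"
    show "?\<phi> (g \<otimes> h) = ?\<phi> g \<otimes>\<^bsub>BijGroup E\<^esub> ?\<phi> h"
      using gh bij mult closed by (auto simp: BijGroup_def compose_def intro!: restrict_ext)
  qed (use bij in \<open>simp add: BijGroup_def\<close>)
  then interpret group_action G E ?\<phi>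
    by (simp add: group_action_def group_hom_def group_hom_axioms_def group_BijGroup)
  have "p dvd card (\<Union> (orbits G E ?\<phi>))"
  proof (rule dvd_partition)
    show "finite (\<Union> (orbits G E ?\<phi>))"
      by (simp add: orbits_coverture assms)
    show "\<forall>c\<in>orbits G E ?\<phi>. p dvd card c"
    proof
      fix c assume "c \<in> orbits G E ?\<phi>"
      then obtain x where x: "x \<in> E" "c = orbit G ?\<phi> x"
        by (auto simp: orbits_def)
      have "card c dvd p ^ n"
        using orbit_stabilizer_theorem[OF x(1)] x(2) assms(2) by (metis dvd_triv_left)
      then obtain i where i: "card c = p ^ i"
        using divides_primepow_nat[OF assms(1)] by blast
      obtain g where g: "g \<in> carrier G" "act g x \<noteq> x"
        using moved x by blast
      \<comment> \<open>Two distinct points in the orbit rule out length one, which leaves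
        \<open>p ^ i\<close> with positive \<open>i\<close>.\<close>
      have "act g x \<in> c" "x \<in> c"
        using g x orbit_refl[OF x(1)] by (auto simp: orbit_def)
      then have "card c \<noteq> 1"
        using g by (auto simp: card_1_singleton_iff)
      then show "p dvd card c"
        using i by (cases i) auto
    qed
    show "\<forall>c1\<in>orbits G E ?\<phi>. \<forall>c2\<in>orbits G E ?\<phi>. c1 \<noteq> c2 \<longrightarrow> c1 \<inter> c2 = {}"
      using disjoint_union by blast
  qed
  then show ?thesis
    by (simp add: orbits_coverture)
qed

text \<open>The moved points form a stable set without fixed points, so their number vanishes modulo
  \<open>p\<close>. Both directions matter: a total prime to \<open>p\<close> forces a fixed point,
  and a total divisible by \<open>p\<close> forces a further one beside a known one.\<close>

lemma (in group) p_group_fixed_points_dvd_iff: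
  assumes "prime p" and "order G = p ^ n" and "finite E"
    and closed: "\<And>g x. g \<in> carrier G \<Longrightarrow> x \<in> E \<Longrightarrow> act g x \<in> E"
    and one: "\<And>x. x \<in> E \<Longrightarrow> act \<one> x = x"
    and mult: "\<And>g h x. g \<in> carrier G \<Longrightarrow> h \<in> carrier G \<Longrightarrow> x \<in> E \<Longrightarrow> act (g \<otimes> h) x = act g (act h x)"
  shows "p dvd card E \<longleftrightarrow> p dvd card {x \<in> E. \<forall>g \<in> carrier G. act g x = x}"
proof -
  let ?Fix = "{x \<in> E. \<forall>g \<in> carrier G. act g x = x}"
  have "p dvd card (E - ?Fix)"
  proof (rule p_group_fixed_point_free_dvd[where act = act, OF assms(1,2)])
    fix g x assume g: "g \<in> carrier G" and x: "x \<in> E - ?Fix"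
    have inv_act: "act (inv g) (act g x) = x"
      using g x mult[of "inv g" g x] one by simp
    have "act g x \<notin> ?Fix"
    proof
      assume fixed: "act g x \<in> ?Fix"
      then have "act g x = x"
        using inv_act g by auto
      then show False
        using fixed x by simp
    qed
    then show "act g x \<in> E - ?Fix"
      using closed[OF g] x by blast
  qed (use assms in auto)
  moreover have "card E = card (E - ?Fix) + card ?Fix"
    using assms(3) by (simp add: card_Diff_subset card_mono)
  ultimately show ?thesis
    by (simp add: dvd_add_right_iff)
qed

text \<open>\<open>A\<close> acts on the cosets of \<open>P\<close> by translation; the inverse in
  \<open>X #> inv a\<close> turns right translation into a left action.\<close>

lemma (in group) rcosets_translation_fixed:
  assumes "prime p" and "finite (carrier G)" and "subgroup A G" and "card A = p ^ n" and "subgroup P G"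
  shows "p dvd card (rcosets P) \<longleftrightarrow> p dvd card {X \<in> rcosets P. \<forall>a\<in>A. X #> inv a = X}"
proof -
  interpret A: group "G\<lparr>carrier := A\<rparr>"
    using assms(3) by (rule subgroup_imp_group)
  have A_sub: "A \<subseteq> carrier G" and P_sub: "P \<subseteq> carrier G"
    using assms by (auto dest: subgroup.subset)
  have sub: "X \<subseteq> carrier G" if "X \<in> rcosets P" for X
    using that subgroup.rcosets_carrier[OF assms(5) is_group] by blast
  have closed: "X #> inv a \<in> rcosets P" if X: "X \<in> rcosets P" and a: "a \<in> A" for X a
  proof -
    obtain g where g: "g \<in> carrier G" "X = P #> g"
      using X by (auto simp: RCOSETS_def)
    then show ?thesis
      using a A_sub P_sub by (metis coset_mult_assoc inv_closed m_closed rcosetsI subsetD)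
  qed
  have "finite (rcosets P)"
    using assms(2) by (simp add: RCOSETS_def)
  then show ?thesis
    using A.p_group_fixed_points_dvd_iff[of p n "rcosets P" "\<lambda>a X. X #> inv a"] assms closed A_sub sub
    by (simp add: order_def inv_mult_group coset_mult_assoc subset_iff)
qed

text \<open>Translates fixed cosets into conjugation: the stabilizer of \<open>P #> g\<close> under
  translation is a conjugate of \<open>P\<close>.\<close>

lemma (in group) rcoset_fixed_iff:
  assumes "subgroup P G" "g \<in> carrier G" "a \<in> carrier G"
  shows "P #> g #> inv a = P #> g \<longleftrightarrow> g \<otimes> a \<otimes> inv g \<in> P"
proof -
  have P_sub: "P \<subseteq> carrier G"
    using assms by (auto dest: subgroup.subset)
  have "P #> g #> inv a = P #> g \<longleftrightarrow> P #> (g \<otimes> inv a) = P #> g"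
    using assms P_sub by (simp add: coset_mult_assoc)
  also have "\<dots> \<longleftrightarrow> g \<otimes> inv (g \<otimes> inv a) \<in> P"
    using assms by (metis inv_closed m_closed repr_independence rcos_self subgroup.rcos_module_imp subgroup.rcos_module_rev is_group)
  finally show ?thesis
    using assms by (simp add: inv_mult_group m_assoc)
qed

section \<open>Sylow conjugation, normalizers and centres in p-groups\<close>

lemma (in group) conj_subgroup:
  assumes "subgroup P G" "h \<in> carrier G"
  shows "subgroup ((\<lambda>y. inv h \<otimes> y \<otimes> h) ` P) G"
proof -
  have "(\<lambda>y. inv h \<otimes> y \<otimes> h) \<in> hom G G"
  proof (rule homI)
    fix x y assume "x \<in> carrier G" "y \<in> carrier G"
    then show "inv h \<otimes> (x \<otimes> y) \<otimes> h = inv h \<otimes> x \<otimes> h \<otimes> (inv h \<otimes> y \<otimes> h)"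
      using assms(2) by (metis inv_closed inv_solve_right' m_assoc m_closed)
  qed (use assms in auto)
  then interpret group_hom G G "\<lambda>y. inv h \<otimes> y \<otimes> h"
    by unfold_locales
  show ?thesis
    using assms(1) by (rule subgroup_img_is_subgroup)
qed

text \<open>The number of cosets is prime to \<open>p\<close>, so \<open>A\<close> fixes one of
  them, and its representative carries \<open>A\<close> into \<open>P\<close>.\<close>

lemma (in group) p_subgroup_conj_into_sylow:
  assumes "prime p" and "finite (carrier G)" and "subgroup A G" and "card A = p ^ n"
    and "subgroup P G" and "\<not> p dvd card (rcosets P)"
  obtains g where "g \<in> carrier G" "\<And>a. a \<in> A \<Longrightarrow> g \<otimes> a \<otimes> inv g \<in> P"
proof -
  have "{X \<in> rcosets P. \<forall>a\<in>A. X #> inv a = X} \<noteq> {}"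
    using rcosets_translation_fixed[OF assms(1-5)] assms(6) by (metis card.empty dvd_0_right)
  then obtain g where "g \<in> carrier G" "\<forall>a\<in>A. P #> g #> inv a = P #> g"
    by (auto simp: RCOSETS_def)
  moreover have "A \<subseteq> carrier G"
    using assms by (auto dest: subgroup.subset)
  ultimately show ?thesis
    using that rcoset_fixed_iff[OF assms(5)] by (metis subsetD)
qed

text \<open>Both groups are conjugate into one Sylow subgroup \<open>P\<close>; conjugating back by
  \<open>h\<close> puts \<open>B\<close> in its old place, so that only \<open>A\<close> moves. In
  the applications \<open>B\<close> is part of \<open>S\<close> and has to stay there.\<close>

lemma (in group) p_subgroups_conj_common:
  assumes "prime p" and "finite (carrier G)" and A: "subgroup A G" "card A = p ^ n"
    and B: "subgroup B G" "card B = p ^ m"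
  obtains x T k where "x \<in> carrier G" "subgroup T G" "card T = p ^ k" "B \<subseteq> T"
    "\<And>a. a \<in> A \<Longrightarrow> inv x \<otimes> a \<otimes> x \<in> T"
proof -
  have "order G \<noteq> 0"
    using assms(2) by (simp add: order_gt_0_iff_finite)
  then obtain k r where kr: "order G = p ^ k * r" "\<not> p dvd r"
    using prime_power_canonical[OF assms(1)] by (metis gr0I mult.commute)
  obtain P where P: "subgroup P G" "card P = p ^ k"
    using sylow_thm[OF assms(1) is_group kr(1) assms(2)] by blast
  have "card (rcosets P) * p ^ k = order G"
    using lagrange[OF P(1)] P(2) by simp
  then have "card (rcosets P) = r"
    using kr assms(1) by (simp add: mult.commute prime_gt_0_nat)
  then have nd: "\<not> p dvd card (rcosets P)"
    using kr by simp
  obtain g where g: "g \<in> carrier G" "\<And>a. a \<in> A \<Longrightarrow> g \<otimes> a \<otimes> inv g \<in> P"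
    using p_subgroup_conj_into_sylow[OF assms(1,2) A P(1) nd] by metis
  obtain h where h: "h \<in> carrier G" "\<And>b. b \<in> B \<Longrightarrow> h \<otimes> b \<otimes> inv h \<in> P"
    using p_subgroup_conj_into_sylow[OF assms(1,2) B P(1) nd] by metis
  let ?c = "\<lambda>y. inv h \<otimes> y \<otimes> h"
  have sub: "A \<subseteq> carrier G" "B \<subseteq> carrier G" "P \<subseteq> carrier G"
    using A B P by (auto dest: subgroup.subset)
  show ?thesis
  proof (rule that[of "inv g \<otimes> h" "?c ` P" k])
    show "subgroup (?c ` P) G"
      using P(1) h(1) by (rule conj_subgroup)
    have "inj_on ?c P"
      using h(1) sub(3) by (auto simp: inj_on_def subset_iff)
    then show "card (?c ` P) = p ^ k"
      using P(2) by (simp add: card_image)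
    show "B \<subseteq> ?c ` P"
    proof
      fix b assume b: "b \<in> B"
      then have "?c (h \<otimes> b \<otimes> inv h) = b"
        using h(1) sub(2) by (auto simp: m_assoc subset_iff) (simp flip: m_assoc)
      then show "b \<in> ?c ` P"
        using h(2)[OF b] by force
    qed
    fix a assume a: "a \<in> A"
    have "inv (inv g \<otimes> h) \<otimes> a \<otimes> (inv g \<otimes> h) = ?c (g \<otimes> a \<otimes> inv g)"
      using a sub(1) g(1) h(1) by (simp add: inv_mult_group m_assoc subset_iff)
    then show "inv (inv g \<otimes> h) \<otimes> a \<otimes> (inv g \<otimes> h) \<in> ?c ` P"
      using g(2)[OF a] by blast
  qed (use g h in simp)
qed

text \<open>\<open>P\<close> acts by translation on its own cosets. Their number is divisible by
  \<open>p\<close>, so the same holds for the number of fixed ones; \<open>P\<close> is fixed, hence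
  so is another coset \<open>P #> g\<close>, and \<open>inv g\<close> is the required
  element.\<close>

lemma (in group) p_group_normalizer_grows:
  assumes "prime p" and "order G = p ^ n" and P: "subgroup P G" and "P \<noteq> carrier G"
  obtains x where "x \<in> carrier G" "x \<notin> P" "\<And>a. a \<in> P \<Longrightarrow> inv x \<otimes> a \<otimes> x \<in> P"
proof -
  have fin: "finite (carrier G)"
    using assms(1,2) order_gt_0_iff_finite by (simp add: prime_gt_0_nat)
  have sub: "P \<subseteq> carrier G"
    using P by (auto dest: subgroup.subset)
  have lag: "card (rcosets P) * card P = p ^ n"
    using lagrange[OF P] assms(2) by simp
  then obtain i j where i: "card P = p ^ i" and j: "card (rcosets P) = p ^ j"
    using divides_primepow_nat[OF assms(1)] by (metis dvd_triv_left dvd_triv_right)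
  have "j \<noteq> 0"
    using lag j assms fin sub by (metis card_subset_eq mult_1 order_def power_0)
  then have "p dvd card (rcosets P)"
    using j by simp
  let ?Fix = "{X \<in> rcosets P. \<forall>a\<in>P. X #> inv a = X}"
  have dvd: "p dvd card ?Fix"
    using \<open>p dvd card (rcosets P)\<close> rcosets_translation_fixed[OF assms(1) fin P i P] by simp
  have "P \<in> ?Fix"
    using subgroup.subgroup_in_rcosets[OF P is_group] P by (auto simp: coset_join2 subgroup.m_inv_closed subgroup.mem_carrier)
  have "?Fix \<noteq> {P}"
    using dvd assms(1) by (metis card_1_singleton_iff One_nat_def not_prime_unit nat_dvd_1_iff_1)
  then obtain X where X: "X \<in> ?Fix" "X \<noteq> P"
    using \<open>P \<in> ?Fix\<close> by blast
  then obtain g where g: "g \<in> carrier G" "X = P #> g"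
    by (auto simp: RCOSETS_def)
  show ?thesis
  proof (rule that[of "inv g"])
    show "inv g \<notin> P"
      using X(2) g P by (metis coset_join2 inv_inv subgroup.m_inv_closed)
    fix a assume "a \<in> P"
    then have "P #> g #> inv a = P #> g"
      using X(1) g(2) by auto
    then show "inv (inv g) \<otimes> a \<otimes> inv g \<in> P"
      using rcoset_fixed_iff[OF P g(1)] \<open>a \<in> P\<close> sub g by auto
  qed (use g in simp)
qed

text \<open>The central elements are the fixed points of the conjugation action of the group on
  itself, and \<open>p\<close> divides their number.\<close>

lemma (in group) p_group_center_nontrivial:
  assumes "prime p" and "order G = p ^ n" and "carrier G \<noteq> {\<one>}"
  obtains z where "z \<in> carrier G" "z \<noteq> \<one>" "\<And>x. x \<in> carrier G \<Longrightarrow> z \<otimes> x = x \<otimes> z"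
proof -
  have fin: "finite (carrier G)"
    using assms(1,2) order_gt_0_iff_finite by (simp add: prime_gt_0_nat)
  have "n \<noteq> 0"
    using assms(2,3) order_one_triv_iff by fastforce
  then have "p dvd card (carrier G)"
    using assms(2) by (simp add: order_def)
  let ?Fix = "{x \<in> carrier G. \<forall>g \<in> carrier G. g \<otimes> x \<otimes> inv g = x}"
  have "p dvd card ?Fix"
    using \<open>p dvd card (carrier G)\<close>
      p_group_fixed_points_dvd_iff[of p n "carrier G" "\<lambda>g x. g \<otimes> x \<otimes> inv g"] assms fin
    by (simp add: inv_mult_group m_assoc)
  then have "?Fix \<noteq> {\<one>}"
    using assms(1) by (metis card_1_singleton_iff One_nat_def not_prime_unit nat_dvd_1_iff_1)
  moreover have "\<one> \<in> ?Fix"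
    by simp
  ultimately obtain z where "z \<in> ?Fix" "z \<noteq> \<one>"
    by blast
  then show ?thesis
    using that[of z] by (simp add: inv_solve_right') (metis inv_solve_right' m_closed)
qed

section \<open>Partial groups\<close>

lemma grp_simps [simp]:
  "carrier (grp L H) = H" "x \<otimes>\<^bsub>grp L H\<^esub> y = pprod L [x, y]" "\<one>\<^bsub>grp L H\<^esub> = pone L"
  "grp L H\<lparr>carrier := K\<rparr> = grp L K"
  by (simp_all add: grp_def)

lemma winv_simps [simp]:
  "winv L [] = []" "winv L [x] = [pinv L x]"
  "winv L (x # w) = winv L w @ [pinv L x]" "winv L (u @ v) = winv L v @ winv L u"
  "length (winv L w) = length w"
  by (simp_all add: winv_def)

context partial_group
begin

lemma Dom_elts: "w \<in> Dom L \<Longrightarrow> w \<in> lists (elts L)"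
  using Dom_words by blast

lemma nil_Dom [simp]: "[] \<in> Dom L"
  using nonempty singleton_Dom Dom_split[of "[]"] by force

lemma one_closed [simp]: "pone L \<in> elts L"
  by (simp add: pone_def prod_closed)

lemma winv_winv [simp]: "w \<in> lists (elts L) \<Longrightarrow> winv L (winv L w) = w"
  by (induction w) (auto simp: inv_inv)

lemma Dom_infix: "u @ v @ w \<in> Dom L \<Longrightarrow> v \<in> Dom L"
  using Dom_split by blast

lemma prod_infix:
  assumes "u @ v @ w \<in> Dom L"
  shows "u @ [pprod L v] @ w \<in> Dom L" "pprod L (u @ [pprod L v] @ w) = pprod L (u @ v @ w)"
  using prod_assoc[OF assms] by auto

lemma prod_one_insert:
  assumes "u @ w \<in> Dom L"
  shows "u @ [pone L] @ w \<in> Dom L" "pprod L (u @ [pone L] @ w) = pprod L (u @ w)"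
  using prod_infix[of u "[]" w] assms by (simp_all add: pone_def)

lemma prod_one_left: "x \<in> elts L \<Longrightarrow> pprod L [pone L, x] = x"
  and prod_one_right: "x \<in> elts L \<Longrightarrow> pprod L [x, pone L] = x"
  using prod_one_insert[of "[]" "[x]"] prod_one_insert[of "[x]" "[]"] singleton_Dom prod_singleton
  by auto

text \<open>Inserting \<open>pone L\<close> is the product axiom for an empty infix, but deleting it
  is not an instance of an axiom. The neutral letter is absorbed by a neighbouring letter instead,
  so the cases differ by which neighbour exists.\<close>

lemma prod_one_delete:
  assumes "u @ [pone L] @ w \<in> Dom L"
  shows "u @ w \<in> Dom L \<and> pprod L (u @ w) = pprod L (u @ [pone L] @ w)"
proof (cases u rule: rev_cases)
  case Nil
  show ?thesis
  proof (cases w)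
    case (Cons x w')
    then show ?thesis
      using Nil assms prod_infix[of "[]" "[pone L, x]" w'] prod_one_left[of x] Dom_elts[OF assms]
      by auto
  qed (use Nil prod_singleton in \<open>simp add: pone_def prod_closed\<close>)
next
  case (snoc u' x)
  then show ?thesis
    using assms prod_infix[of u' "[x, pone L]" w] prod_one_right[of x] Dom_elts[OF assms] by auto
qed

lemma inv_prod_left: "x \<in> elts L \<Longrightarrow> [pinv L x, x] \<in> Dom L \<and> pprod L [pinv L x, x] = pone L"
  using inv_word[of "[x]"] singleton_Dom by simp

lemma inv_prod_right: "x \<in> elts L \<Longrightarrow> [x, pinv L x] \<in> Dom L \<and> pprod L [x, pinv L x] = pone L"
  using inv_prod_left[of "pinv L x"] by (simp add: inv_closed inv_inv)

lemma cancel_right: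
  assumes "u @ [g, pinv L g] @ w \<in> Dom L"
  shows "u @ w \<in> Dom L" "pprod L (u @ [g, pinv L g] @ w) = pprod L (u @ w)"
proof -
  have "g \<in> elts L"
    using Dom_elts[OF assms] by simp
  then have "u @ [pone L] @ w \<in> Dom L" "pprod L (u @ [pone L] @ w) = pprod L (u @ [g, pinv L g] @ w)"
    using prod_infix[OF assms] inv_prod_right by auto
  then show "u @ w \<in> Dom L" "pprod L (u @ [g, pinv L g] @ w) = pprod L (u @ w)"
    using prod_one_delete by auto
qed

lemma cancel_left:
  assumes "u @ [pinv L g, g] @ w \<in> Dom L" "g \<in> elts L"
  shows "u @ w \<in> Dom L" "pprod L (u @ [pinv L g, g] @ w) = pprod L (u @ w)"
  using cancel_right[of u "pinv L g" w] assms by (simp_all add: inv_inv)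

lemma winv_lists: "w \<in> lists (elts L) \<Longrightarrow> winv L w \<in> lists (elts L)"
  by (auto simp: winv_def inv_closed)

lemma winv_Dom: "w \<in> Dom L \<Longrightarrow> winv L w \<in> Dom L"
  using inv_word Dom_split by blast

lemma Dom_append_winv: "w \<in> Dom L \<Longrightarrow> w @ winv L w \<in> Dom L"
  using inv_word[of "winv L w"] winv_Dom Dom_elts by simp

lemma inv_unique:
  assumes "[a, b] \<in> Dom L" "pprod L [a, b] = pone L"
  shows "a = pinv L b"
proof -
  have ab: "a \<in> elts L" "b \<in> elts L"
    using Dom_elts[OF assms(1)] by auto
  \<comment> \<open>A word followed by its inverse lies in the domain; the prefix
    \<open>[a, b, pinv L b]\<close> can then be evaluated in two ways.\<close>
  have "[a, b] @ [pinv L b] @ [pinv L a] \<in> Dom L"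
    using Dom_append_winv[OF assms(1)] by simp
  then have "[a, b, pinv L b] \<in> Dom L"
    using Dom_split[of "[a, b, pinv L b]"] by simp
  then show ?thesis
    using cancel_right[of "[a]" b "[]"] prod_infix[of "[]" "[a, b]" "[pinv L b]"] assms(2) ab
    by (simp add: prod_singleton prod_one_left inv_closed)
qed

lemma prod_winv:
  assumes "w \<in> Dom L"
  shows "pprod L (winv L w) = pinv L (pprod L w)"
proof -
  have D: "winv L w @ w @ [] \<in> Dom L" and one: "pprod L (winv L w @ w) = pone L"
    using inv_word[OF assms] by auto
  have "[] @ winv L w @ [pprod L w] \<in> Dom L" "pprod L (winv L w @ [pprod L w]) = pone L"
    using prod_infix[OF D] one by auto
  from prod_infix[OF this(1)] this(2) show ?thesis
    by (intro inv_unique) auto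
qed

lemma inv_one [simp]: "pinv L (pone L) = pone L"
  using inv_prod_right[of "pone L"] prod_one_left[of "pinv L (pone L)"] by (simp add: inv_closed)

section \<open>Conjugation in a partial group\<close>

lemma conj_domI: "[pinv L g, x, g] \<in> Dom L \<Longrightarrow> x \<in> conj_dom L g"
  using Dom_elts[of "[pinv L g, x, g]"] by (auto simp: conj_dom_def)

lemma conj_domD: "x \<in> conj_dom L g \<Longrightarrow> [pinv L g, x, g] \<in> Dom L \<and> x \<in> elts L \<and> g \<in> elts L"
  using Dom_elts[of "[pinv L g, x, g]"] by (auto simp: conj_dom_def)

lemma one_conj: "g \<in> elts L \<Longrightarrow> pone L \<in> conj_dom L g \<and> conjg L g (pone L) = pone L"
  using prod_one_insert[of "[pinv L g]" "[g]"] inv_prod_left by (auto simp: conjg_def intro: conj_domI)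

lemma conj_one: "x \<in> elts L \<Longrightarrow> x \<in> conj_dom L (pone L) \<and> conjg L (pone L) x = x"
  using prod_one_insert[of "[]" "[x]"] prod_one_insert[of "[pone L, x]" "[]"]
    singleton_Dom prod_singleton by (auto simp: conjg_def intro!: conj_domI)

text \<open>The longer words come from the inversion axiom: the inverse of
  \<open>[pinv L g, x, g]\<close> followed by that word contains \<open>[g, pinv L g, x, g]\<close>
  as a suffix.\<close>

lemma conj_commute_word:
  assumes "x \<in> conj_dom L g"
  shows "[g, pinv L g, x, g] \<in> Dom L" "[x, g] \<in> Dom L" "[g, conjg L g x] \<in> Dom L"
    "pprod L [g, conjg L g x] = pprod L [x, g]"
proof -
  have D: "[pinv L g, x, g] \<in> Dom L" and e: "x \<in> elts L" "g \<in> elts L"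
    using conj_domD[OF assms] by auto
  have "[pinv L g, pinv L x] @ [g, pinv L g, x, g] \<in> Dom L"
    using inv_word[OF D] e by (simp add: inv_inv)
  then show D4: "[g, pinv L g, x, g] \<in> Dom L"
    using Dom_split by blast
  show "[x, g] \<in> Dom L" "[g, conjg L g x] \<in> Dom L" "pprod L [g, conjg L g x] = pprod L [x, g]"
    using cancel_right[of "[]" g "[x, g]"] prod_infix[of "[g]" "[pinv L g, x, g]" "[]"] D4
    by (simp_all add: conjg_def)
qed

lemma conj_inv_cancel:
  assumes "x \<in> conj_dom L g"
  shows "conjg L g x \<in> conj_dom L (pinv L g)" "conjg L (pinv L g) (conjg L g x) = x"
proof -
  have e: "x \<in> elts L" "g \<in> elts L"
    using conj_domD[OF assms] by auto
  \<comment> \<open>The four-letter word of the previous lemma followed by its inverse; its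
    five-letter prefix is evaluated in two ways.\<close>
  have "[g, pinv L g, x, g, pinv L g] @ [pinv L x, g, pinv L g] \<in> Dom L"
    using Dom_append_winv[OF conj_commute_word(1)[OF assms]] e by (simp add: inv_inv)
  then have D: "[g, pinv L g, x, g, pinv L g] \<in> Dom L"
    using Dom_split by blast
  have D3: "[g, conjg L g x, pinv L g] \<in> Dom L"
    and eq: "pprod L [g, conjg L g x, pinv L g] = pprod L [g, pinv L g, x, g, pinv L g]"
    using prod_infix[of "[g]" "[pinv L g, x, g]" "[pinv L g]"] D by (simp_all add: conjg_def)
  show "conjg L g x \<in> conj_dom L (pinv L g)"
    using D3 e by (intro conj_domI) (simp add: inv_inv)
  have "pprod L [g, pinv L g, x, g, pinv L g] = pprod L [x, g, pinv L g]" "[x, g, pinv L g] \<in> Dom L"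
    using cancel_right[of "[]" g "[x, g, pinv L g]"] D by auto
  moreover have "pprod L [x, g, pinv L g] = x"
    using cancel_right[of "[x]" g "[]"] calculation(2) e by (simp add: prod_singleton)
  ultimately show "conjg L (pinv L g) (conjg L g x) = x"
    using eq e by (simp add: conjg_def inv_inv)
qed

lemma conj_inv_cancel':
  assumes "x \<in> conj_dom L (pinv L g)" "g \<in> elts L"
  shows "conjg L (pinv L g) x \<in> conj_dom L g" "conjg L g (conjg L (pinv L g) x) = x"
  using conj_inv_cancel[OF assms(1)] assms(2) by (simp_all add: inv_inv)

lemma inj_on_conj: "inj_on (conjg L g) (conj_dom L g)"
  by (metis conj_inv_cancel(2) inj_onI)

lemma conj_pinv:
  assumes "x \<in> conj_dom L g"
  shows "pinv L x \<in> conj_dom L g" "conjg L g (pinv L x) = pinv L (conjg L g x)"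
  using prod_winv[of "[pinv L g, x, g]"] winv_Dom[of "[pinv L g, x, g]"] conj_domD[OF assms]
  by (auto simp: conjg_def inv_inv intro: conj_domI)

text \<open>Conjugability of \<open>x\<close> and \<open>y\<close> by \<open>g\<close> alone does
  not make their product conjugable. The six-letter word suffices, and in a locality it comes from a
  chain of objects.\<close>

lemma conj_mult:
  assumes "[pinv L g, x, g, pinv L g, y, g] \<in> Dom L"
  shows "pprod L [x, y] \<in> conj_dom L g" "conjg L g (pprod L [x, y]) = pprod L [conjg L g x, conjg L g y]"
proof -
  have D: "[pinv L g, x] @ [g, pinv L g] @ [y, g] \<in> Dom L"
    using assms by simp
  have D2: "[pinv L g] @ [x, y] @ [g] \<in> Dom L"
    and eq: "pprod L [pinv L g, x, y, g] = pprod L [pinv L g, x, g, pinv L g, y, g]"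
    using cancel_right[OF D] by simp_all
  then show "pprod L [x, y] \<in> conj_dom L g"
    using prod_infix[OF D2] by (auto intro: conj_domI)
  have "pprod L [pinv L g, x, g, pinv L g, y, g] = pprod L [conjg L g x, conjg L g y]"
    using prod_infix[of "[]" "[pinv L g, x, g]" "[pinv L g, y, g]"] assms
      prod_infix[of "[conjg L g x]" "[pinv L g, y, g]" "[]"] by (simp add: conjg_def)
  then show "conjg L g (pprod L [x, y]) = pprod L [conjg L g x, conjg L g y]"
    using eq prod_infix[OF D2] by (simp add: conjg_def)
qed

lemma conj_by_word:
  assumes "winv L w @ [y] @ w \<in> Dom L"
  shows "y \<in> conj_dom L (pprod L w)" "conjg L (pprod L w) y = pprod L (winv L w @ [y] @ w)"
proof -
  have w: "w \<in> Dom L"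
    using assms Dom_split by blast
  have D: "(winv L w @ [y]) @ w @ [] \<in> Dom L"
    using assms by simp
  have D2: "[] @ winv L w @ [y, pprod L w] \<in> Dom L"
    and e: "pprod L (winv L w @ [y, pprod L w]) = pprod L (winv L w @ [y] @ w)"
    using prod_infix[OF D] by simp_all
  have "[pinv L (pprod L w), y, pprod L w] \<in> Dom L"
    "pprod L [pinv L (pprod L w), y, pprod L w] = pprod L (winv L w @ [y] @ w)"
    using prod_infix[OF D2] e prod_winv[OF w] by simp_all
  then show "y \<in> conj_dom L (pprod L w)" "conjg L (pprod L w) y = pprod L (winv L w @ [y] @ w)"
    by (auto simp: conjg_def intro: conj_domI)
qed

lemma conj_by_append:
  assumes "winv L (u @ v) @ [y] @ (u @ v) \<in> Dom L"
  shows "conjg L (pprod L (u @ v)) y = conjg L (pprod L v) (conjg L (pprod L u) y)"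
proof -
  have D: "winv L v @ (winv L u @ [y] @ u) @ v \<in> Dom L"
    using assms by simp
  then have "winv L u @ [y] @ u \<in> Dom L"
    using Dom_infix by blast
  then show ?thesis
    using prod_infix[OF D] conj_by_word[of u y] conj_by_word[OF assms]
      conj_by_word[of v "conjg L (pprod L u) y"] by simp
qed

section \<open>Subgroups of a partial group as ordinary groups\<close>

lemma pg_subgroup_iff:
  "pg_subgroup L H \<longleftrightarrow> H \<subseteq> elts L \<and> lists H \<subseteq> Dom L \<and> (\<forall>h\<in>H. pinv L h \<in> H) \<and> pone L \<in> H \<and>
    (\<forall>x\<in>H. \<forall>y\<in>H. pprod L [x, y] \<in> H)"
proof
  assume "pg_subgroup L H"
  then show "H \<subseteq> elts L \<and> lists H \<subseteq> Dom L \<and> (\<forall>h\<in>H. pinv L h \<in> H) \<and> pone L \<in> H \<and>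
    (\<forall>x\<in>H. \<forall>y\<in>H. pprod L [x, y] \<in> H)"
    by (auto simp: pg_subgroup_def partial_subgroup_def pone_def subset_iff)
next
  assume H: "H \<subseteq> elts L \<and> lists H \<subseteq> Dom L \<and> (\<forall>h\<in>H. pinv L h \<in> H) \<and> pone L \<in> H \<and>
    (\<forall>x\<in>H. \<forall>y\<in>H. pprod L [x, y] \<in> H)"
  \<comment> \<open>Binary products suffice because every word over \<open>H\<close> is in the
    domain, so its first letter can be split off.\<close>
  have "pprod L v \<in> H" if "v \<in> lists H" for v
    using that
  proof (induction v)
    case (Cons x v)
    then have "x # v \<in> lists H"
      by simp
    then have "x # v \<in> Dom L"
      using H by blast
    then have "[x] @ v @ [] \<in> Dom L"
      by simp
    then have "pprod L (x # v) = pprod L [x, pprod L v]"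
      using prod_infix by fastforce
    then show ?case
      using Cons H by auto
  qed (use H in \<open>simp add: pone_def\<close>)
  then show "pg_subgroup L H"
    using H by (auto simp: pg_subgroup_def partial_subgroup_def)
qed

lemma pg_subgroupD:
  assumes "pg_subgroup L H"
  shows "H \<subseteq> elts L" "lists H \<subseteq> Dom L" "h \<in> H \<Longrightarrow> pinv L h \<in> H" "pone L \<in> H"
    "x \<in> H \<Longrightarrow> y \<in> H \<Longrightarrow> pprod L [x, y] \<in> H"
  using assms by (auto simp: pg_subgroup_iff)

lemma group_grp:
  assumes "pg_subgroup L H"
  shows "group (grp L H)"
proof (rule groupI)
  fix x y z assume "x \<in> carrier (grp L H)" "y \<in> carrier (grp L H)" "z \<in> carrier (grp L H)"
  then have D: "[x, y, z] \<in> Dom L"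
    using pg_subgroupD(2)[OF assms] by (auto simp: subset_iff)
  then show "x \<otimes>\<^bsub>grp L H\<^esub> y \<otimes>\<^bsub>grp L H\<^esub> z = x \<otimes>\<^bsub>grp L H\<^esub> (y \<otimes>\<^bsub>grp L H\<^esub> z)"
    using prod_infix[of "[]" "[x, y]" "[z]"] prod_infix[of "[x]" "[y, z]" "[]"] by simp
next
  fix x assume x: "x \<in> carrier (grp L H)"
  then have "x \<in> elts L"
    using pg_subgroupD(1)[OF assms] by auto
  then show "\<one>\<^bsub>grp L H\<^esub> \<otimes>\<^bsub>grp L H\<^esub> x = x"
    "\<exists>y\<in>carrier (grp L H). y \<otimes>\<^bsub>grp L H\<^esub> x = \<one>\<^bsub>grp L H\<^esub>"
    using x prod_one_left inv_prod_left pg_subgroupD(3)[OF assms] by (auto intro!: bexI[of _ "pinv L x"])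
qed (use pg_subgroupD[OF assms] in auto)

lemma inv_grp:
  assumes "pg_subgroup L H" "x \<in> H"
  shows "inv\<^bsub>grp L H\<^esub> x = pinv L x"
proof -
  interpret group "grp L H"
    using assms(1) by (rule group_grp)
  show ?thesis
    using assms pg_subgroupD[OF assms(1)] inv_prod_left
    by (intro inv_equality) auto
qed

lemma conj_grp:
  assumes "pg_subgroup L H" "x \<in> H" "y \<in> H"
  shows "y \<in> conj_dom L x" "conjg L x y = inv\<^bsub>grp L H\<^esub> x \<otimes>\<^bsub>grp L H\<^esub> y \<otimes>\<^bsub>grp L H\<^esub> x" "conjg L x y \<in> H"
proof -
  have D: "[pinv L x, y, x] \<in> Dom L"
    using assms pg_subgroupD[OF assms(1)] by (auto simp: subset_iff)
  then show "y \<in> conj_dom L x"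
    by (rule conj_domI)
  show eq: "conjg L x y = inv\<^bsub>grp L H\<^esub> x \<otimes>\<^bsub>grp L H\<^esub> y \<otimes>\<^bsub>grp L H\<^esub> x"
    using D prod_infix[of "[]" "[pinv L x, y]" "[x]"] inv_grp[OF assms(1,2)] by (simp add: conjg_def)
  show "conjg L x y \<in> H"
    using pg_subgroupD[OF assms(1)] assms by (simp add: eq inv_grp)
qed

lemma subgroup_grp_iff:
  assumes "pg_subgroup L N"
  shows "subgroup H (grp L N) \<longleftrightarrow> H \<subseteq> N \<and> pg_subgroup L H"
proof -
  have "subgroup H (grp L N) \<longleftrightarrow> H \<subseteq> N \<and> (\<forall>h\<in>H. pinv L h \<in> H) \<and> pone L \<in> H \<and>
    (\<forall>x\<in>H. \<forall>y\<in>H. pprod L [x, y] \<in> H)"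
    using inv_grp[OF assms] by (auto simp: subgroup_def subset_iff)
  also have "\<dots> \<longleftrightarrow> H \<subseteq> N \<and> pg_subgroup L H"
    using pg_subgroupD(1,2)[OF assms] lists_mono[of H N] unfolding pg_subgroup_iff by blast
  finally show ?thesis .
qed

lemma pg_subgroup_Int:
  "pg_subgroup L H \<Longrightarrow> pg_subgroup L K \<Longrightarrow> pg_subgroup L (H \<inter> K)"
  unfolding pg_subgroup_iff by auto

lemma p_subgroup_subset:
  assumes "prime p" and H: "p_subgroup p L H" and K: "pg_subgroup L K" "K \<subseteq> H"
  shows "p_subgroup p L K"
proof -
  interpret group "grp L H"
    using H by (auto simp: p_subgroup_def intro: group_grp)
  have "subgroup K (grp L H)"
    using H K by (simp add: p_subgroup_def subgroup_grp_iff)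
  then have "card K dvd card H"
    using lagrange[of K] by (metis dvd_triv_right grp_simps(1) order_def)
  then show ?thesis
    using H K divides_primepow_nat[OF assms(1)] finite_subset by (force simp: p_subgroup_def)
qed

lemma p_subgroup_common_conj:
  assumes "prime p" and N: "pg_subgroup L N" "finite N"
    and A: "p_subgroup p L A" "A \<subseteq> N" and B: "p_subgroup p L B" "B \<subseteq> N"
  obtains x T where "x \<in> N" "p_subgroup p L T" "T \<subseteq> N" "B \<subseteq> T" "conjg L x ` A \<subseteq> T"
proof -
  interpret group "grp L N"
    using N(1) by (rule group_grp)
  obtain n m where cards: "card A = p ^ n" "card B = p ^ m"
    using A B by (auto simp: p_subgroup_def)
  have subs: "subgroup A (grp L N)" "subgroup B (grp L N)"
    using A B N by (auto simp: subgroup_grp_iff p_subgroup_def)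
  have "finite (carrier (grp L N))"
    using N(2) by simp
  from p_subgroups_conj_common[OF assms(1) this subs(1) cards(1) subs(2) cards(2)] obtain x T k where T: "x \<in> carrier (grp L N)" "subgroup T (grp L N)" "card T = p ^ k" "B \<subseteq> T"
    "\<And>a. a \<in> A \<Longrightarrow> inv\<^bsub>grp L N\<^esub> x \<otimes>\<^bsub>grp L N\<^esub> a \<otimes>\<^bsub>grp L N\<^esub> x \<in> T"
    by blast
  have x: "x \<in> N"
    using T(1) by simp
  have "conjg L x ` A \<subseteq> T"
    using T(5) A(2) conj_grp(2)[OF N(1) x] by auto
  moreover have "p_subgroup p L T" "T \<subseteq> N"
    using T(2,3) N by (auto simp: subgroup_grp_iff p_subgroup_def dest: finite_subset)
  ultimately show ?thesis
    using that x T by blast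
qed

text \<open>Conjugation is injective, so on a finite set inclusion of the image is already
  equality.\<close>

lemma normalizer_mem_finite:
  assumes "g \<in> elts L" "A \<subseteq> conj_dom L g" "conjg L g ` A \<subseteq> A" "finite A"
  shows "g \<in> pnormalizer L A"
  using assms inj_on_subset[OF inj_on_conj assms(2)] endo_inj_surj[OF assms(4,3)]
  by (simp add: pnormalizer_def)

lemma mem_normalizer_in_group_iff:
  assumes "pg_subgroup L N" "x \<in> N" "A \<subseteq> N" "finite A"
  shows "x \<in> pnormalizer L A \<longleftrightarrow> conjg L x ` A \<subseteq> A"
proof
  have "A \<subseteq> conj_dom L x"
    using conj_grp(1)[OF assms(1,2)] assms(3) by blast
  moreover have "x \<in> elts L"
    using pg_subgroupD(1)[OF assms(1)] assms(2) by blast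
  ultimately show "x \<in> pnormalizer L A" if "conjg L x ` A \<subseteq> A"
    using normalizer_mem_finite that assms(4) by blast
qed (auto simp: pnormalizer_def)

lemma subset_normalizer:
  assumes "pg_subgroup L P" "finite P"
  shows "P \<subseteq> pnormalizer L P"
  using mem_normalizer_in_group_iff[OF assms(1) _ order_refl assms(2)] conj_grp(3)[OF assms(1)] by blast

lemma p_subgroup_normalizer_grows:
  assumes "prime p" and T: "p_subgroup p L T" and P: "pg_subgroup L P" "P \<subset> T"
  shows "P \<subset> T \<inter> pnormalizer L P"
proof -
  have T': "pg_subgroup L T" and fin: "finite T"
    using T by (auto simp: p_subgroup_def)
  interpret group "grp L T"
    using T' by (rule group_grp)
  obtain n where "order (grp L T) = p ^ n"
    using T by (auto simp: p_subgroup_def order_def)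
  moreover have "subgroup P (grp L T)" "P \<noteq> carrier (grp L T)"
    using P T' by (auto simp: subgroup_grp_iff)
  ultimately obtain x where "x \<in> carrier (grp L T)" "x \<notin> P"
    "\<And>a. a \<in> P \<Longrightarrow> inv\<^bsub>grp L T\<^esub> x \<otimes>\<^bsub>grp L T\<^esub> a \<otimes>\<^bsub>grp L T\<^esub> x \<in> P"
    by (rule p_group_normalizer_grows[OF assms(1), of n P]) blast
  then have x: "x \<in> T" "x \<notin> P" and conj: "\<And>a. a \<in> P \<Longrightarrow> conjg L x a \<in> P"
    using conj_grp(2)[OF T', of x] P(2) by auto
  have "finite P"
    using fin P(2) finite_subset by blast
  then have "x \<in> pnormalizer L P"
    using mem_normalizer_in_group_iff[OF T' x(1)] P(2) conj by blast
  moreover have "P \<subseteq> pnormalizer L P"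
    using subset_normalizer[OF P(1) \<open>finite P\<close>] .
  ultimately show ?thesis
    using x P by blast
qed

lemma group_center_subgroup:
  assumes "pg_subgroup L H"
  shows "pg_subgroup L (group_center L H)"
proof -
  interpret group "grp L H"
    using assms by (rule group_grp)
  have "subgroup (group_center L H) (grp L H)"
  proof (rule subgroupI)
    have "\<forall>x\<in>H. pprod L [pone L, x] = pprod L [x, pone L]"
      using pg_subgroupD(1)[OF assms] prod_one_left prod_one_right by (simp add: subset_iff)
    then have "pone L \<in> group_center L H"
      using pg_subgroupD(4)[OF assms] by (simp add: group_center_def)
    then show "group_center L H \<noteq> {}"
      by blast
  next
    fix a assume a: "a \<in> group_center L H"
    have "inv\<^bsub>grp L H\<^esub> a \<otimes>\<^bsub>grp L H\<^esub> x = x \<otimes>\<^bsub>grp L H\<^esub> inv\<^bsub>grp L H\<^esub> a" if "x \<in> H" for x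
    proof -
      have "a \<in> carrier (grp L H)" "x \<in> carrier (grp L H)" "a \<otimes>\<^bsub>grp L H\<^esub> x = x \<otimes>\<^bsub>grp L H\<^esub> a"
        using a that by (auto simp: group_center_def)
      then show ?thesis
        by (metis inv_closed inv_solve_left inv_solve_right m_assoc m_closed)
    qed
    moreover have "a \<in> H"
      using a by (simp add: group_center_def)
    ultimately show "inv\<^bsub>grp L H\<^esub> a \<in> group_center L H"
      using pg_subgroupD(3)[OF assms] inv_grp[OF assms] unfolding group_center_def grp_simps by simp
  next
    fix a b assume a: "a \<in> group_center L H" and b: "b \<in> group_center L H"
    have "a \<otimes>\<^bsub>grp L H\<^esub> b \<otimes>\<^bsub>grp L H\<^esub> x = x \<otimes>\<^bsub>grp L H\<^esub> (a \<otimes>\<^bsub>grp L H\<^esub> b)" if "x \<in> H" for x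
    proof -
      have c: "a \<in> carrier (grp L H)" "b \<in> carrier (grp L H)" "x \<in> carrier (grp L H)"
        "a \<otimes>\<^bsub>grp L H\<^esub> x = x \<otimes>\<^bsub>grp L H\<^esub> a" "b \<otimes>\<^bsub>grp L H\<^esub> x = x \<otimes>\<^bsub>grp L H\<^esub> b"
        using a b that by (auto simp: group_center_def)
      then show ?thesis
        by (metis m_assoc)
    qed
    moreover have "a \<in> H" "b \<in> H"
      using a b by (simp_all add: group_center_def)
    ultimately show "a \<otimes>\<^bsub>grp L H\<^esub> b \<in> group_center L H"
      using pg_subgroupD(5)[OF assms] unfolding group_center_def grp_simps by blast
  next
    show "group_center L H \<subseteq> carrier (grp L H)"
      by (simp add: group_center_def)
  qed
  then show ?thesis
    using subgroup_grp_iff[OF assms] by simp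
qed

lemma group_center_nontrivial:
  assumes "prime p" and "p_subgroup p L H" and "H \<noteq> {pone L}"
  shows "group_center L H \<noteq> {pone L}"
proof -
  interpret group "grp L H"
    using assms(2) by (auto simp: p_subgroup_def intro: group_grp)
  obtain n where "order (grp L H) = p ^ n"
    using assms(2) by (auto simp: p_subgroup_def order_def)
  moreover have "carrier (grp L H) \<noteq> {\<one>\<^bsub>grp L H\<^esub>}"
    using assms(3) by simp
  ultimately obtain z where "z \<in> carrier (grp L H)" "z \<noteq> \<one>\<^bsub>grp L H\<^esub>"
    "\<And>x. x \<in> carrier (grp L H) \<Longrightarrow> z \<otimes>\<^bsub>grp L H\<^esub> x = x \<otimes>\<^bsub>grp L H\<^esub> z"
    by (rule p_group_center_nontrivial[OF assms(1), of n]) blast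
  then have "z \<in> group_center L H" "z \<noteq> pone L"
    by (simp_all add: group_center_def)
  then show ?thesis
    by blast
qed

lemma conj_eq_iff_commute:
  assumes "pg_subgroup L H" "x \<in> H" "y \<in> H"
  shows "conjg L x y = y \<longleftrightarrow> pprod L [y, x] = pprod L [x, y]"
proof -
  interpret group "grp L H"
    using assms(1) by (rule group_grp)
  have xy: "x \<in> carrier (grp L H)" "y \<in> carrier (grp L H)"
    using assms by auto
  have "inv\<^bsub>grp L H\<^esub> x \<otimes>\<^bsub>grp L H\<^esub> y \<otimes>\<^bsub>grp L H\<^esub> x = y \<longleftrightarrow> y \<otimes>\<^bsub>grp L H\<^esub> x = x \<otimes>\<^bsub>grp L H\<^esub> y"
    using xy by (metis inv_closed inv_solve_left' m_assoc m_closed)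
  then show ?thesis
    using conj_grp(2)[OF assms] by simp
qed

end

section \<open>Conjugation in localities\<close>

context locality
begin

lemma S_pg: "pg_subgroup L S" and finite_S: "finite S"
  using S_p_subgroup by (auto simp: p_subgroup_def)

lemma S_elts: "S \<subseteq> elts L"
  using pg_subgroupD(1)[OF S_pg] .

lemma DeltaD:
  assumes "P \<in> \<Delta>"
  shows "P \<subseteq> S" "pg_subgroup L P" "finite P"
  using Delta_subgroups[OF assms] S_pg finite_S by (auto simp: subgroup_grp_iff dest: finite_subset)

lemma Delta_over: "P \<in> \<Delta> \<Longrightarrow> pg_subgroup L R \<Longrightarrow> R \<subseteq> S \<Longrightarrow> P \<subseteq> R \<Longrightarrow> R \<in> \<Delta>"
  using L3_over S_pg by (simp add: subgroup_grp_iff)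

section \<open>Chains of objects\<close>

definition step :: "'a set \<Rightarrow> 'a \<Rightarrow> 'a set \<Rightarrow> bool" where
  "step P g R \<longleftrightarrow> P \<in> \<Delta> \<and> R \<in> \<Delta> \<and> g \<in> elts L \<and> P \<subseteq> conj_dom L g \<and> conjg L g ` P = R"

text \<open>The chain of condition \<open>L2\<close>, read recursively along the word. Its two ends
  are recorded so that chains can be concatenated, reversed and collapsed.\<close>

primrec path :: "'a set \<Rightarrow> 'a list \<Rightarrow> 'a set \<Rightarrow> bool" where
  "path P [] R \<longleftrightarrow> P \<in> \<Delta> \<and> P = R"
| "path P (g # w) R \<longleftrightarrow> (\<exists>T. step P g T \<and> path T w R)"

lemma stepD:
  assumes "step P g R"
  shows "P \<in> \<Delta>" "R \<in> \<Delta>" "g \<in> elts L" "P \<subseteq> conj_dom L g" "conjg L g ` P = R"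
  using assms by (auto simp: step_def)

lemma path_iff_chain:
  "path P w R \<longleftrightarrow> w \<in> lists (elts L) \<and> (\<exists>f. f 0 = P \<and> f (length w) = R \<and> (\<forall>i\<le>length w. f i \<in> \<Delta>) \<and>
    (\<forall>i<length w. f i \<subseteq> conj_dom L (w ! i) \<and> conjg L (w ! i) ` f i = f (Suc i)))"
proof (induction w arbitrary: P)
  case Nil
  show ?case
    by auto
next
  case (Cons g w)
  show ?case (is "_ \<longleftrightarrow> _ \<and> (\<exists>f. ?C f)")
  proof
    assume "path P (g # w) R"
    then obtain T f where *: "step P g T" "w \<in> lists (elts L)" "f 0 = T" "f (length w) = R"
      "\<forall>i\<le>length w. f i \<in> \<Delta>"
      "\<forall>i<length w. f i \<subseteq> conj_dom L (w ! i) \<and> conjg L (w ! i) ` f i = f (Suc i)"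
      using Cons.IH by auto
    have "?C (case_nat P f)"
    proof (intro conjI allI impI)
      fix i assume "i \<le> length (g # w)"
      then show "case_nat P f i \<in> \<Delta>"
        using * stepD(1)[OF *(1)] by (cases i) auto
    next
      fix i assume i: "i < length (g # w)"
      show "case_nat P f i \<subseteq> conj_dom L ((g # w) ! i)"
        "conjg L ((g # w) ! i) ` case_nat P f i = case_nat P f (Suc i)"
        using * stepD[OF *(1)] i by (cases i; simp)+
    qed (use * in simp_all)
    then show "g # w \<in> lists (elts L) \<and> (\<exists>f. ?C f)"
      using *(2) stepD(3)[OF *(1)] by (intro conjI exI[of _ "case_nat P f"]) simp_all
  next
    assume "g # w \<in> lists (elts L) \<and> (\<exists>f. ?C f)"
    then obtain f where f: "?C f" and w: "g \<in> elts L" "w \<in> lists (elts L)"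
      by auto
    have "f 0 \<in> \<Delta>" "f 1 \<in> \<Delta>"
    proof -
      have "\<forall>i\<le>Suc (length w). f i \<in> \<Delta>"
        using f by simp
      then show "f 0 \<in> \<Delta>" "f 1 \<in> \<Delta>"
        by auto
    qed
    moreover have "f 0 \<subseteq> conj_dom L g" "conjg L g ` f 0 = f 1"
    proof -
      have "f 0 \<subseteq> conj_dom L ((g # w) ! 0) \<and> conjg L ((g # w) ! 0) ` f 0 = f (Suc 0)"
        using f by blast
      then show "f 0 \<subseteq> conj_dom L g" "conjg L g ` f 0 = f 1"
        by simp_all
    qed
    ultimately have "step P g (f 1)"
      using f w by (simp add: step_def)
    moreover have "path (f 1) w R"
      unfolding Cons.IH
    proof (intro conjI exI[of _ "\<lambda>i. f (Suc i)"] allI impI)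
      fix i assume "i < length w"
      then have "f (Suc i) \<subseteq> conj_dom L ((g # w) ! Suc i) \<and>
          conjg L ((g # w) ! Suc i) ` f (Suc i) = f (Suc (Suc i))"
        using f by (metis Suc_less_eq length_Cons)
      then show "f (Suc i) \<subseteq> conj_dom L (w ! i)" "conjg L (w ! i) ` f (Suc i) = f (Suc (Suc i))"
        by simp_all
    qed (use f w in auto)
    ultimately show "path P (g # w) R"
      by auto
  qed
qed

lemma path_Cons: "step P g T \<Longrightarrow> path T w R \<Longrightarrow> path P (g # w) R"
  and path_single: "step P g R \<Longrightarrow> path P [g] R"
  by (auto simp: step_def)

lemma path_Dom:
  assumes "path P w R"
  shows "w \<in> Dom L"
  using assms L2[of w] unfolding path_iff_chain by blast

lemma Dom_path:
  assumes "w \<in> Dom L"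
  obtains P R where "path P w R"
  using assms L2[OF Dom_elts[OF assms]] Dom_elts[OF assms] unfolding path_iff_chain by blast

lemma path_append: "path P (u @ v) R \<longleftrightarrow> (\<exists>T. path P u T \<and> path T v R)"
proof (induction u arbitrary: P)
  case Nil
  have "path P v R \<Longrightarrow> P \<in> \<Delta>"
    by (cases v) (auto dest: stepD)
  then show ?case
    by auto
next
  case (Cons g u)
  show ?case
    unfolding append_Cons path.simps Cons.IH by blast
qed

lemma step_inv:
  assumes "step P g R"
  shows "step R (pinv L g) P"
proof -
  note * = stepD[OF assms]
  have "R \<subseteq> conj_dom L (pinv L g)"
    using * conj_inv_cancel(1) by blast
  moreover have "conjg L (pinv L g) ` R = P"
    using *(4,5) conj_inv_cancel(2)[of _ g] by (auto simp: image_image subset_iff)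
  ultimately show ?thesis
    using * by (simp add: step_def inv_closed)
qed

lemma path_winv: "path P w R \<Longrightarrow> path R (winv L w) P"
proof (induction w arbitrary: P)
  case (Cons g w)
  then obtain T where "step P g T" "path T w R"
    by auto
  then show ?case
    using Cons.IH[of T] step_inv[of P g T] by (auto simp: path_append step_def)
qed auto

lemma mem_normalizer_iff: "P \<in> \<Delta> \<Longrightarrow> y \<in> pnormalizer L P \<longleftrightarrow> step P y P"
  by (auto simp: step_def pnormalizer_def)

lemma step_in_S:
  assumes "P \<in> \<Delta>" "s \<in> S"
  shows "step P s (conjg L s ` P)"
proof -
  interpret group "grp L S"
    using S_pg by (rule group_grp)
  have PS: "P \<subseteq> conj_dom L s" "s \<in> elts L"
    using DeltaD(1)[OF assms(1)] conj_grp(1)[OF S_pg assms(2)] assms(2) S_elts by blast+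
  have "conjg L s ` P = (\<lambda>y. inv\<^bsub>grp L S\<^esub> s \<otimes>\<^bsub>grp L S\<^esub> y \<otimes>\<^bsub>grp L S\<^esub> s) ` P"
    using DeltaD(1)[OF assms(1)] conj_grp(2)[OF S_pg assms(2)] by (intro image_cong) auto
  then have "subgroup (conjg L s ` P) (grp L S)"
    using conj_subgroup[OF Delta_subgroups[OF assms(1)], of s] assms(2) by simp
  then show ?thesis
    using PS assms L3_conj[OF assms(1) PS(2,1)] by (simp add: step_def)
qed

text \<open>From \<open>R\<close> the inverse word leads back to \<open>P\<close>, \<open>y\<close>
  keeps \<open>P\<close> in place, and \<open>w\<close> leads forward again: a closed chain at
  \<open>R\<close>.\<close>

lemma path_conj_Dom:
  assumes "path P w R" "y \<in> pnormalizer L P"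
  shows "winv L w @ [y] @ w \<in> Dom L"
proof -
  have "P \<in> \<Delta>"
    using assms(1) unfolding path_iff_chain by blast
  then have "path R (winv L w @ [y] @ w) R"
    using path_winv[OF assms(1)] assms mem_normalizer_iff[of P y] by (auto simp: path_append)
  then show ?thesis
    by (rule path_Dom)
qed

text \<open>Elements of \<open>P\<close> normalize \<open>P\<close>, so their conjugation words lie
  in the domain and conjugation by the product is the composite of the conjugations by the letters.
  The chain thus collapses to one link.\<close>

lemma step_prod: "path P w R \<Longrightarrow> step P (pprod L w) R"
proof (induction w arbitrary: P)
  case Nil
  then show ?case
    using DeltaD(2)[of P] pg_subgroupD(1)[of P] conj_one one_closed
    by (auto simp: step_def subset_iff simp flip: pone_def)
next
  case (Cons g w)
  then obtain T where T: "step P g T" "path T w R"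
    by auto
  have D: "winv L (g # w) @ [y] @ (g # w) \<in> Dom L" if "y \<in> P" for y
    using path_conj_Dom[OF Cons.prems] that DeltaD[of P] subset_normalizer[of P] stepD[OF T(1)] by blast
  have "P \<subseteq> conj_dom L (pprod L (g # w))"
    using conj_by_word(1)[OF D] by blast
  moreover have "conjg L (pprod L (g # w)) ` P = conjg L (pprod L w) ` conjg L g ` P"
    using conj_by_append[of "[g]" w] D stepD[OF T(1)] prod_singleton by (auto simp: image_image)
  moreover have "pprod L (g # w) \<in> elts L"
    using path_Dom[OF Cons.prems] by (rule prod_closed)
  ultimately show ?case
    using stepD[OF T(1)] stepD[OF Cons.IH[OF T(2)]] by (simp add: step_def)
qed

lemma conj_prod2:
  assumes "path P [g, h] R" "y \<in> pnormalizer L P"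
  shows "conjg L (pprod L [g, h]) y = conjg L h (conjg L g y)"
proof -
  have "g \<in> elts L" "h \<in> elts L"
    using Dom_elts[OF path_Dom[OF assms(1)]] by auto
  then show ?thesis
    using conj_by_append[of "[g]" "[h]" y] path_conj_Dom[OF assms] by (simp add: prod_singleton)
qed

section \<open>Normalizers of objects and conjugation between them\<close>

lemma normalizer_pg:
  assumes "P \<in> \<Delta>"
  shows "pg_subgroup L (pnormalizer L P)"
  unfolding pg_subgroup_iff
proof (intro conjI ballI)
  \<comment> \<open>Each letter fixes \<open>P\<close>, so every word over the normalizer has a
    constant chain. This is what makes the normalizer of an object a genuine group.\<close>
  have path: "path P w P" if "w \<in> lists (pnormalizer L P)" for w
    using that assms by (induction w) (auto simp: mem_normalizer_iff)
  then show "lists (pnormalizer L P) \<subseteq> Dom L"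
    using path_Dom by blast
  show "pone L \<in> pnormalizer L P"
    using step_prod[OF path[of "[]"]] assms by (simp add: pone_def mem_normalizer_iff)
  fix x assume x: "x \<in> pnormalizer L P"
  then show "pinv L x \<in> pnormalizer L P"
    using step_inv assms by (simp add: mem_normalizer_iff)
  fix y assume "y \<in> pnormalizer L P"
  then show "pprod L [x, y] \<in> pnormalizer L P"
    using x step_prod[OF path[of "[x, y]"]] assms by (simp add: mem_normalizer_iff)
qed (auto simp: pnormalizer_def)

text \<open>The chain \<open>R\<close>, \<open>P\<close>, \<open>P\<close>, \<open>R\<close> for
  \<open>[pinv L g, y, g]\<close> does both jobs: the conjugate is defined, and it fixes
  \<open>R\<close>.\<close>

lemma normalizer_conj:
  assumes "step P g R" "y \<in> pnormalizer L P"
  shows "y \<in> conj_dom L g" "conjg L g y \<in> pnormalizer L R"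
proof -
  have "step P y P"
    using assms(2) stepD(1)[OF assms(1)] by (simp add: mem_normalizer_iff)
  then have path: "path R [pinv L g, y, g] R"
    by (intro path_Cons[OF step_inv[OF assms(1)]] path_Cons[of P y P] path_single[OF assms(1)])
  show "y \<in> conj_dom L g"
    using path_Dom[OF path] by (rule conj_domI)
  show "conjg L g y \<in> pnormalizer L R"
    using step_prod[OF path] stepD(2)[OF assms(1)] by (simp add: conjg_def mem_normalizer_iff)
qed

lemma normalizer_conj_mult:
  assumes "step P g R" "x \<in> pnormalizer L P" "y \<in> pnormalizer L P"
  shows "conjg L g (pprod L [x, y]) = pprod L [conjg L g x, conjg L g y]"
proof (rule conj_mult)
  have "step P x P" "step P y P"
    using assms(2,3) stepD(1)[OF assms(1)] by (simp_all add: mem_normalizer_iff)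
  then have "path R [pinv L g, x, g, pinv L g, y, g] R"
    using assms(1) step_inv[OF assms(1)] by (intro path_Cons path_single)
  then show "[pinv L g, x, g, pinv L g, y, g] \<in> Dom L"
    by (rule path_Dom)
qed

lemma conj_pg_subgroup:
  assumes "step P g R" "pg_subgroup L T" "T \<subseteq> pnormalizer L P"
  shows "pg_subgroup L (conjg L g ` T)" "conjg L g ` T \<subseteq> pnormalizer L R" "T \<subseteq> conj_dom L g"
proof -
  note PR = stepD[OF assms(1)]
  show sub: "conjg L g ` T \<subseteq> pnormalizer L R" and dom: "T \<subseteq> conj_dom L g"
    using normalizer_conj[OF assms(1)] assms(3) by blast+
  have "lists (conjg L g ` T) \<subseteq> Dom L" "conjg L g ` T \<subseteq> elts L"
    using lists_mono[OF sub] sub pg_subgroupD(1,2)[OF normalizer_pg[OF PR(2)]] by blast+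
  moreover have "pinv L h \<in> conjg L g ` T" if "h \<in> conjg L g ` T" for h
  proof -
    obtain a where a: "a \<in> T" "h = conjg L g a"
      using \<open>h \<in> conjg L g ` T\<close> by blast
    then show ?thesis
      using conj_pinv(2)[of a g] dom pg_subgroupD(3)[OF assms(2), of a] by (metis image_eqI subsetD)
  qed
  moreover have "pone L \<in> conjg L g ` T"
    using pg_subgroupD(4)[OF assms(2)] one_conj[OF PR(3)] by (metis image_eqI)
  moreover have "pprod L [x, y] \<in> conjg L g ` T" if x: "x \<in> conjg L g ` T" and y: "y \<in> conjg L g ` T" for x y
  proof -
    obtain a b where ab: "a \<in> T" "x = conjg L g a" "b \<in> T" "y = conjg L g b"
      using x y by blast
    then have "pprod L [x, y] = conjg L g (pprod L [a, b])"
      using normalizer_conj_mult[OF assms(1), of a b] assms(3) by (simp add: subset_iff)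
    then show ?thesis
      using ab pg_subgroupD(5)[OF assms(2)] by simp
  qed
  ultimately show "pg_subgroup L (conjg L g ` T)"
    unfolding pg_subgroup_iff by blast
qed

lemma conj_p_subgroup:
  assumes "step P g R" "p_subgroup p L T" "T \<subseteq> pnormalizer L P"
  shows "p_subgroup p L (conjg L g ` T)" "card (conjg L g ` T) = card T"
proof -
  have T: "pg_subgroup L T" "finite T"
    using assms(2) by (auto simp: p_subgroup_def)
  note * = conj_pg_subgroup[OF assms(1) T(1) assms(3)]
  show card: "card (conjg L g ` T) = card T"
    using inj_on_subset[OF inj_on_conj *(3)] by (rule card_image)
  show "p_subgroup p L (conjg L g ` T)"
    using assms(2) * card T by (simp add: p_subgroup_def)
qed

text \<open>The smaller object lies in the normalizer of \<open>P\<close>, on which conjugation is a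
  homomorphism; its image is therefore a subgroup of \<open>S\<close>, and \<open>\<Delta>\<close>
  is closed under conjugation.\<close>

lemma step_restrict:
  assumes "step P g R" "Q \<in> \<Delta>" "Q \<subseteq> P"
  shows "step Q g (conjg L g ` Q)"
proof -
  have Q: "Q \<subseteq> pnormalizer L P"
    using assms(3) subset_normalizer[OF DeltaD(2,3)[OF stepD(1)[OF assms(1)]]] by blast
  note * = conj_pg_subgroup[OF assms(1) DeltaD(2)[OF assms(2)] Q]
  have "conjg L g ` Q \<subseteq> S"
    using stepD[OF assms(1)] assms(3) DeltaD(1)[of R] by blast
  then have "conjg L g ` Q \<in> \<Delta>"
    using L3_conj[OF assms(2) stepD(3)[OF assms(1)] *(3)] *(1) S_pg by (simp add: subgroup_grp_iff)
  then show ?thesis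
    using assms stepD[OF assms(1)] *(3) by (simp add: step_def)
qed

text \<open>A Sylow theorem for p-subgroups between an object and its normalizer. The intersection
  \<open>T \<inter> S\<close> is enlarged by conjugation, and the induction hypothesis is used
  twice: for a p-subgroup \<open>B\<close> of the normalizer of \<open>T \<inter> S\<close>, then
  for a conjugate of \<open>T\<close>.\<close>

lemma p_subgroup_conj_into_S:
  assumes "P \<in> \<Delta>" "P \<subseteq> T" "T \<subseteq> pnormalizer L P" "p_subgroup p L T"
  shows "\<exists>t R. step P t R \<and> conjg L t ` T \<subseteq> S"
  using assms
proof (induction "card S - card (T \<inter> S)" arbitrary: P T rule: less_induct)
  case less
  note P = less.prems(1) and PT = less.prems(2) and TN = less.prems(3) and T = less.prems(4)
  have Tpg: "pg_subgroup L T" and finT: "finite T"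
    using T by (auto simp: p_subgroup_def)
  show ?case
  proof (cases "T \<subseteq> S")
    case True
    have "step P (pone L) P"
      using P one_closed conj_one DeltaD(2)[OF P] pg_subgroupD(1)[of P] by (auto simp: step_def subset_iff)
    moreover have "conjg L (pone L) ` T \<subseteq> S"
      using True conj_one pg_subgroupD(1)[OF Tpg] by (simp add: image_subset_iff subset_iff)
    ultimately show ?thesis
      by blast
  next
    case False
    let ?P0 = "T \<inter> S"
    have P0pg: "pg_subgroup L ?P0"
      using Tpg S_pg by (rule pg_subgroup_Int)
    have P0: "?P0 \<in> \<Delta>"
      using Delta_over[OF P P0pg] PT DeltaD(1)[OF P] by blast
    \<comment> \<open>Otherwise \<open>S\<close> is contained in \<open>T\<close>, and maximality of
      \<open>S\<close> gives \<open>T = S\<close>. So \<open>?P0\<close> is proper in both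
      \<open>S\<close> and \<open>T\<close> and has a larger normalizer in each.\<close>
    have "?P0 \<noteq> S"
      using L1[OF T] False by blast
    then have S0: "?P0 \<subset> S \<inter> pnormalizer L ?P0"
      by (intro p_subgroup_normalizer_grows[OF prime_p S_p_subgroup P0pg]) blast
    have T0: "?P0 \<subset> T \<inter> pnormalizer L ?P0"
      using False by (intro p_subgroup_normalizer_grows[OF prime_p T P0pg]) blast
    let ?N = "pnormalizer L ?P0"
    have N: "pg_subgroup L ?N" "finite ?N"
      using normalizer_pg[OF P0] finite_subset[OF _ finite_elts] by (auto simp: pnormalizer_def)
    have T0p: "p_subgroup p L (T \<inter> ?N)" and S0p: "p_subgroup p L (S \<inter> ?N)"
      using p_subgroup_subset[OF prime_p T] p_subgroup_subset[OF prime_p S_p_subgroup]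
        pg_subgroup_Int[OF Tpg N(1)] pg_subgroup_Int[OF S_pg N(1)] by blast+
    obtain x B where x: "x \<in> ?N" and B: "p_subgroup p L B" "B \<subseteq> ?N" "S \<inter> ?N \<subseteq> B"
      "conjg L x ` (T \<inter> ?N) \<subseteq> B"
      using p_subgroup_common_conj[OF prime_p N T0p _ S0p] by blast
    \<comment> \<open>\<open>B\<close> contains \<open>S \<inter> ?N\<close>, so it meets
      \<open>S\<close> in more than \<open>?P0\<close> does, and the induction hypothesis covers
      \<open>B\<close> over the object \<open>?P0\<close>.\<close>
    have "card ?P0 < card (S \<inter> ?N)"
      using S0 finite_S by (intro psubset_card_mono) auto
    also have "\<dots> \<le> card (B \<inter> S)"
      using B(3) finite_S by (intro card_mono) auto
    finally have lt: "card ?P0 < card (B \<inter> S)" .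
    have le: "card (X \<inter> S) \<le> card S" for X
      using finite_S by (intro card_mono) auto
    have "?P0 \<subseteq> B"
      using S0 B(3) by blast
    then obtain t R0 where t: "step ?P0 t R0" "conjg L t ` B \<subseteq> S"
      using less.hyps[OF _ P0 _ B(2,1)] lt le[of B] by (metis diff_less_mono2 less_le_trans)
    have xstep: "step ?P0 x ?P0"
      using x P0 by (simp add: mem_normalizer_iff)
    have path0: "path ?P0 [x, t] R0"
      using path_Cons[OF xstep path_single[OF t(1)]] .
    \<comment> \<open>\<open>T\<close> need not normalize \<open>?P0\<close>, but it normalizes
      \<open>P\<close>. Restricting the chain to \<open>P\<close> ensures that conjugation by
      \<open>k\<close> is defined on all of \<open>T\<close>.\<close>
    define R where "R = conjg L t ` conjg L x ` P"
    have PP0: "P \<subseteq> ?P0"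
      using PT DeltaD(1)[OF P] by blast
    have s1: "step P x (conjg L x ` P)"
      using step_restrict[OF xstep P PP0] .
    have s2: "step (conjg L x ` P) t R"
      unfolding R_def using step_restrict[OF t(1) stepD(2)[OF s1]] PP0 stepD(5)[OF xstep] by blast
    have pathP: "path P [x, t] R"
      using path_Cons[OF s1 path_single[OF s2]] .
    define k where "k = pprod L [x, t]"
    have k: "step P k R"
      using step_prod[OF pathP] by (simp add: k_def)
    let ?T' = "conjg L k ` T"
    have T': "p_subgroup p L ?T'" "?T' \<subseteq> pnormalizer L R" "R \<subseteq> ?T'"
      using conj_p_subgroup[OF k T TN] conj_pg_subgroup[OF k Tpg TN] stepD(5)[OF k] PT by auto
    \<comment> \<open>Conjugation by \<open>k\<close> brings \<open>T \<inter> ?N\<close> into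
      \<open>S\<close>. As this group is larger than \<open>?P0\<close>, the measure drops for
      \<open>?T'\<close>.\<close>
    have "conjg L k y = conjg L t (conjg L x y)" if "y \<in> ?N" for y
      using conj_prod2[OF path0 that] by (simp add: k_def)
    then have "conjg L k ` (T \<inter> ?N) \<subseteq> S"
      using B(4) t(2) by (simp add: image_subset_iff)
    then have "conjg L k ` (T \<inter> ?N) \<subseteq> ?T' \<inter> S"
      by blast
    then have "card (conjg L k ` (T \<inter> ?N)) \<le> card (?T' \<inter> S)"
      using finite_S by (intro card_mono) auto
    moreover have "card (conjg L k ` (T \<inter> ?N)) = card (T \<inter> ?N)"
      using conj_pg_subgroup(3)[OF k Tpg TN] inj_on_subset[OF inj_on_conj] by (intro card_image) blast
    moreover have "card ?P0 < card (T \<inter> ?N)"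
      using T0 finT by (intro psubset_card_mono) auto
    ultimately have "card S - card (?T' \<inter> S) < card S - card ?P0"
      using le[of ?T'] by linarith
    then obtain t' R' where t': "step R t' R'" "conjg L t' ` ?T' \<subseteq> S"
      using less.hyps[OF _ stepD(2)[OF k] T'(3,2,1)] by blast
    have path': "path P [k, t'] R'"
      using path_Cons[OF k path_single[OF t'(1)]] .
    have "conjg L (pprod L [k, t']) y = conjg L t' (conjg L k y)" if "y \<in> T" for y
      using conj_prod2[OF path'] that TN by blast
    then have "conjg L (pprod L [k, t']) ` T \<subseteq> S"
      using t'(2) by auto
    then show ?thesis
      using step_prod[OF path'] by blast
  qed
qed

section \<open>The subgroups \<open>S\<^sub>g\<close>\<close>

text \<open>With \<open>b = conjg L g a\<close> the product of \<open>[pinv L a, g, b]\<close> is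
  again \<open>g\<close>, and this word has a chain starting at the conjugate of \<open>P\<close> by
  \<open>a\<close>. So conjugation by elements of \<open>S_elt L S g\<close> takes starting objects
  for \<open>g\<close> to starting objects for \<open>g\<close>.\<close>

lemma S_elt_mult_aux:
  assumes "step P g R" "a \<in> S_elt L S g"
  shows "\<exists>T. step (conjg L a ` P) g T"
proof -
  define b where "b = conjg L g a"
  have a: "a \<in> S" "a \<in> conj_dom L g" and b: "b \<in> S"
    using assms(2) by (auto simp: S_elt_def b_def)
  have e: "a \<in> elts L" "g \<in> elts L"
    using a(1) S_elts stepD[OF assms(1)] by blast+
  note s1 = step_inv[OF step_in_S[OF stepD(1)[OF assms(1)] a(1)]]
  note s2 = step_in_S[OF stepD(2)[OF assms(1)] b]
  have path: "path (conjg L a ` P) [pinv L a, g, b] (conjg L b ` R)"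
    using path_Cons[OF s1 path_Cons[OF assms(1) path_single[OF s2]]] .
  have "pprod L [pinv L a, g, b] = pprod L [pinv L a, pprod L [g, b]]"
    using prod_infix[of "[pinv L a]" "[g, b]" "[]"] path_Dom[OF path] by simp
  also have "pprod L [g, b] = pprod L [a, g]"
    unfolding b_def using conj_commute_word(4)[OF a(2)] .
  also have D: "[pinv L a, a, g] \<in> Dom L"
    using inv_word[OF conj_commute_word(2)[OF a(2)]] Dom_split[of "[pinv L g]" "[pinv L a, a, g]"] by simp
  then have "pprod L [pinv L a, pprod L [a, g]] = pprod L [pinv L a, a, g]"
    using prod_infix[of "[pinv L a]" "[a, g]" "[]"] by simp
  also have "\<dots> = g"
    using cancel_left[of "[]" a "[g]"] D e by (simp add: prod_singleton)
  finally show ?thesis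
    using step_prod[OF path] by auto
qed

lemma S_elt_Dom:
  assumes "g \<in> elts L" "x \<in> S_elt L S g" "y \<in> S_elt L S g"
  shows "[pinv L g, x, g, pinv L g, y, g] \<in> Dom L"
proof -
  obtain P R where "path P [g] R"
    using Dom_path[OF singleton_Dom[OF assms(1)]] .
  then have s: "step P g R"
    by (auto simp: step_def)
  obtain T where T: "step (conjg L x ` P) g T"
    using S_elt_mult_aux[OF s assms(2)] by blast
  obtain T' where T': "step (conjg L y ` conjg L x ` P) g T'"
    using S_elt_mult_aux[OF T assms(3)] by blast
  have xy: "x \<in> S" "y \<in> S"
    using assms by (auto simp: S_elt_def)
  \<comment> \<open>The chain runs through \<open>R\<close>, \<open>P\<close>, the conjugate of
    \<open>P\<close> by \<open>x\<close>, \<open>T\<close>, that conjugate again, its conjugate by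
    \<open>y\<close>, and \<open>T'\<close>.\<close>
  have "path R [pinv L g, x, g, pinv L g, y, g] T'"
    using step_inv[OF s] step_in_S[OF stepD(1)[OF s] xy(1)] T step_inv[OF T]
      step_in_S[OF stepD(1)[OF T] xy(2)] T' by (intro path_Cons path_single)
  then show ?thesis
    by (rule path_Dom)
qed

lemma S_elt_mult:
  assumes "g \<in> elts L" "x \<in> S_elt L S g" "y \<in> S_elt L S g"
  shows "pprod L [x, y] \<in> S_elt L S g" "conjg L g (pprod L [x, y]) = pprod L [conjg L g x, conjg L g y]"
  using conj_mult[OF S_elt_Dom[OF assms]] assms pg_subgroupD(5)[OF S_pg] by (auto simp: S_elt_def)

lemma S_elt_pg: "g \<in> elts L \<Longrightarrow> pg_subgroup L (S_elt L S g)"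
proof -
  assume g: "g \<in> elts L"
  have "S_elt L S g \<subseteq> S"
    by (auto simp: S_elt_def)
  then have "lists (S_elt L S g) \<subseteq> Dom L" "S_elt L S g \<subseteq> elts L"
    using lists_mono[of "S_elt L S g" S] pg_subgroupD(2)[OF S_pg] S_elts by blast+
  moreover have "pinv L x \<in> S_elt L S g" if "x \<in> S_elt L S g" for x
    using that conj_pinv[of x g] pg_subgroupD(3)[OF S_pg] by (simp add: S_elt_def)
  moreover have "pone L \<in> S_elt L S g"
    using one_conj[OF g] pg_subgroupD(4)[OF S_pg] by (simp add: S_elt_def)
  ultimately show ?thesis
    using S_elt_mult(1)[OF g] unfolding pg_subgroup_iff by blast
qed

text \<open>Any link by \<open>g\<close> starts inside \<open>S_elt L S g\<close>, and one exists
  because \<open>[g]\<close> is in the domain. Closure under overgroups then makes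
  \<open>S_elt L S g\<close> the largest starting object for \<open>g\<close>.\<close>

lemma S_elt_step:
  assumes "g \<in> elts L"
  shows "step (S_elt L S g) g (conjg L g ` S_elt L S g)"
proof -
  let ?A = "S_elt L S g"
  obtain P R where "path P [g] R"
    using Dom_path[OF singleton_Dom[OF assms(1)]] .
  then have s: "step P g R"
    by (auto simp: step_def)
  have "P \<subseteq> ?A"
    using stepD[OF s] DeltaD(1) by (fastforce simp: S_elt_def)
  then have A: "?A \<in> \<Delta>"
    using Delta_over[OF stepD(1)[OF s] S_elt_pg[OF assms]] by (auto simp: S_elt_def)
  have dom: "?A \<subseteq> conj_dom L g" and im: "conjg L g ` ?A \<subseteq> S"
    by (auto simp: S_elt_def)
  have "pg_subgroup L (conjg L g ` ?A)"
    unfolding pg_subgroup_iff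
  proof (intro conjI ballI)
    show "conjg L g ` ?A \<subseteq> elts L" "lists (conjg L g ` ?A) \<subseteq> Dom L"
      using subset_trans[OF im S_elts] subset_trans[OF lists_mono[OF im] pg_subgroupD(2)[OF S_pg]] by auto
    show "pone L \<in> conjg L g ` ?A"
      using pg_subgroupD(4)[OF S_elt_pg[OF assms]] one_conj[OF assms] by (metis image_eqI)
  next
    fix h assume "h \<in> conjg L g ` ?A"
    then obtain a where a: "a \<in> ?A" "h = conjg L g a"
      by blast
    then show "pinv L h \<in> conjg L g ` ?A"
      using conj_pinv(2)[of a g] dom pg_subgroupD(3)[OF S_elt_pg[OF assms], of a] by (metis image_eqI subsetD)
  next
    fix x y assume "x \<in> conjg L g ` ?A" "y \<in> conjg L g ` ?A"
    then obtain a b where ab: "a \<in> ?A" "x = conjg L g a" "b \<in> ?A" "y = conjg L g b"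
      by blast
    then have "pprod L [x, y] = conjg L g (pprod L [a, b])"
      using S_elt_mult(2)[OF assms, of a b] by simp
    then show "pprod L [x, y] \<in> conjg L g ` ?A"
      using S_elt_mult(1)[OF assms] ab by blast
  qed
  then have "conjg L g ` ?A \<in> \<Delta>"
    using L3_conj[OF A assms dom] im S_pg by (simp add: subgroup_grp_iff)
  then show ?thesis
    using A assms dom by (simp add: step_def)
qed

lemma S_elt_conj_pg:
  assumes "g \<in> elts L" "pg_subgroup L Q" "Q \<subseteq> S_elt L S g"
  shows "pg_subgroup L (conjg L g ` Q)"
  using conj_pg_subgroup(1)[OF S_elt_step[OF assms(1)] assms(2)] assms(3)
    subset_normalizer[OF S_elt_pg[OF assms(1)]] finite_subset[OF _ finite_S, of "S_elt L S g"]
  by (auto simp: S_elt_def)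

end

section \<open>Conjugation by words\<close>

lemma S_word_Nil [simp]: "S_word L S [] = S"
  by (auto simp: S_word_def)

lemma S_word_Cons: "S_word L S (g # w) = {x \<in> S_elt L S g. conjg L g x \<in> S_word L S w}"
proof (intro equalityI subsetI)
  fix x assume "x \<in> S_word L S (g # w)"
  then obtain y where y: "y 0 = x" "\<And>i. i \<le> Suc (length w) \<Longrightarrow> y i \<in> S"
    "\<And>i. i < Suc (length w) \<Longrightarrow> y i \<in> conj_dom L ((g # w) ! i) \<and> conjg L ((g # w) ! i) (y i) = y (Suc i)"
    by (auto simp: S_word_def)
  have y0: "x \<in> conj_dom L g" "conjg L g x = y (Suc 0)"
    using y(3)[of 0] y(1) by auto
  have "y (Suc 0) \<in> S_word L S w"
    unfolding S_word_def
  proof (intro CollectI conjI exI[of _ "\<lambda>i. y (Suc i)"] allI impI)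
    fix i assume "i < length w"
    then show "y (Suc i) \<in> conj_dom L (w ! i)" "conjg L (w ! i) (y (Suc i)) = y (Suc (Suc i))"
      using y(3)[of "Suc i"] by auto
  qed (use y(2) in auto)
  then show "x \<in> {x \<in> S_elt L S g. conjg L g x \<in> S_word L S w}"
    using y0 y(1) y(2)[of 0] y(2)[of 1] by (simp add: S_elt_def)
next
  fix x assume "x \<in> {x \<in> S_elt L S g. conjg L g x \<in> S_word L S w}"
  then obtain y where x: "x \<in> S" "x \<in> conj_dom L g" and y: "y 0 = conjg L g x"
    "\<And>i. i \<le> length w \<Longrightarrow> y i \<in> S"
    "\<And>i. i < length w \<Longrightarrow> y i \<in> conj_dom L (w ! i) \<and> conjg L (w ! i) (y i) = y (Suc i)"
    by (auto simp: S_word_def S_elt_def)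
  show "x \<in> S_word L S (g # w)"
    unfolding S_word_def
  proof (intro CollectI conjI exI[of _ "case_nat x y"] allI impI)
    fix i assume "i \<le> length (g # w)"
    then show "case_nat x y i \<in> S"
      using x y(2) by (cases i) auto
  next
    fix i assume "i < length (g # w)"
    then show "case_nat x y i \<in> conj_dom L ((g # w) ! i)"
      "conjg L ((g # w) ! i) (case_nat x y i) = case_nat x y (Suc i)"
      using x y(1,3) by (cases i; simp)+
  qed (use x in simp_all)
qed

lemma S_word_subset: "S_word L S w \<subseteq> S"
  by (auto simp: S_word_def)

text \<open>\<open>fold (conjg L) w\<close> is conjugation letter by letter. It is meaningful on
  \<open>S_word L S w\<close> for every word, whereas \<open>pprod L w\<close> has a meaning only
  for words in \<open>Dom L\<close>.\<close>

lemma fold_conj_S_word: "x \<in> S_word L S w \<Longrightarrow> fold (conjg L) w x \<in> S"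
  by (induction w arbitrary: x) (auto simp: S_word_Cons)

lemma S_word_append:
  "x \<in> S_word L S (u @ v) \<longleftrightarrow> x \<in> S_word L S u \<and> fold (conjg L) u x \<in> S_word L S v"
  using S_word_subset[of L S v] by (induction u arbitrary: x) (auto simp: S_word_Cons)

context locality
begin

lemma S_word_mult:
  assumes "w \<in> lists (elts L)" "x \<in> S_word L S w" "y \<in> S_word L S w"
  shows "pprod L [x, y] \<in> S_word L S w \<and>
    fold (conjg L) w (pprod L [x, y]) = pprod L [fold (conjg L) w x, fold (conjg L) w y]"
  using assms
proof (induction w arbitrary: x y)
  case Nil
  then show ?case
    using pg_subgroupD(5)[OF S_pg] by simp
next
  case (Cons g w)
  then show ?case
    using S_elt_mult[of g x y] by (simp add: S_word_Cons)
qed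

lemma S_word_pinv:
  assumes "w \<in> lists (elts L)" "x \<in> S_word L S w"
  shows "pinv L x \<in> S_word L S w \<and> fold (conjg L) w (pinv L x) = pinv L (fold (conjg L) w x)"
  using assms
proof (induction w arbitrary: x rule: list.induct)
  case Nil
  then show ?case
    using pg_subgroupD(3)[OF S_pg] by simp
next
  case (Cons g w)
  then have "x \<in> S_elt L S g" "conjg L g (pinv L x) = pinv L (conjg L g x)"
    using conj_pinv(2)[of x g] by (simp_all add: S_word_Cons S_elt_def)
  moreover from this have "pinv L x \<in> S_elt L S g"
    using Cons.prems(1) pg_subgroupD(3)[OF S_elt_pg[of g]] by simp
  ultimately show ?case
    using Cons by (simp add: S_word_Cons)
qed

lemma S_word_one:
  "w \<in> lists (elts L) \<Longrightarrow> pone L \<in> S_word L S w \<and> fold (conjg L) w (pone L) = pone L"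
proof (induction w)
  case Nil
  then show ?case
    using pg_subgroupD(4)[OF S_pg] by simp
next
  case (Cons g w)
  then show ?case
    using one_conj[of g] pg_subgroupD(4)[OF S_elt_pg, of g] by (simp add: S_word_Cons)
qed

lemma pg_subgroup_of_S:
  assumes "A \<subseteq> S" "pone L \<in> A" "\<And>x. x \<in> A \<Longrightarrow> pinv L x \<in> A"
    "\<And>x y. x \<in> A \<Longrightarrow> y \<in> A \<Longrightarrow> pprod L [x, y] \<in> A"
  shows "pg_subgroup L A"
  using assms subset_trans[OF assms(1) S_elts]
    subset_trans[OF lists_mono[OF assms(1)] pg_subgroupD(2)[OF S_pg]]
  unfolding pg_subgroup_iff by simp

lemma S_word_pg: "w \<in> lists (elts L) \<Longrightarrow> pg_subgroup L (S_word L S w)"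
  by (rule pg_subgroup_of_S) (simp_all add: S_word_subset S_word_one S_word_pinv S_word_mult del: in_lists_conv_set)

lemma fold_conj_pg:
  assumes "w \<in> lists (elts L)" "pg_subgroup L Q" "Q \<subseteq> S_word L S w"
  shows "pg_subgroup L (fold (conjg L) w ` Q)"
proof (rule pg_subgroup_of_S)
  let ?c = "fold (conjg L) w"
  note Q = pg_subgroupD[OF assms(2)]
  show "?c ` Q \<subseteq> S"
    using fold_conj_S_word[OF subsetD[OF assms(3)]] by (rule image_subsetI)
  show "pone L \<in> ?c ` Q"
    using Q(4) S_word_one[OF assms(1)] by (metis image_eqI)
  fix x assume "x \<in> ?c ` Q"
  then obtain a where a: "a \<in> Q" "x = ?c a"
    by blast
  then have "pinv L x = ?c (pinv L a)"
    using S_word_pinv[OF assms(1) subsetD[OF assms(3) a(1)]] by simp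
  then show "pinv L x \<in> ?c ` Q"
    using Q(3)[OF a(1)] by (rule image_eqI)
  fix y assume "y \<in> ?c ` Q"
  then obtain b where b: "b \<in> Q" "y = ?c b"
    by blast
  then have "pprod L [x, y] = ?c (pprod L [a, b])"
    using a S_word_mult[OF assms(1) subsetD[OF assms(3) a(1)] subsetD[OF assms(3) b(1)]] by simp
  then show "pprod L [x, y] \<in> ?c ` Q"
    using Q(5)[OF a(1) b(1)] by (rule image_eqI)
qed

lemma fold_conj_winv:
  assumes "w \<in> lists (elts L)" "x \<in> S_word L S w"
  shows "fold (conjg L) w x \<in> S_word L S (winv L w) \<and>
    fold (conjg L) (winv L w) (fold (conjg L) w x) = x"
  using assms
proof (induction w arbitrary: x)
  case (Cons g w)
  then have x: "x \<in> S_elt L S g" "conjg L g x \<in> S_word L S w"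
    by (simp_all add: S_word_Cons)
  then have "conjg L g x \<in> S_elt L S (pinv L g)" "conjg L (pinv L g) (conjg L g x) = x"
    using conj_inv_cancel[of x g] by (simp_all add: S_elt_def)
  then show ?case
    using Cons x by (simp add: S_word_append S_word_Cons S_elt_def)
qed simp

lemma inj_on_fold_conj: "w \<in> lists (elts L) \<Longrightarrow> inj_on (fold (conjg L) w) (S_word L S w)"
  by (rule inj_on_inverseI[of _ "fold (conjg L) (winv L w)"]) (simp add: fold_conj_winv del: in_lists_conv_set)

lemma path_S_word: "path P w R \<Longrightarrow> P \<subseteq> S_word L S w"
proof (induction w arbitrary: P)
  case Nil
  then have "P \<in> \<Delta>"
    by auto
  then show ?case
    using DeltaD(1)[of P] by simp
next
  case (Cons g w)
  then obtain T where T: "step P g T" "T \<subseteq> S_word L S w"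
    by auto
  note PT = stepD[OF T(1)]
  show ?case
    using PT(4,5) T(2) DeltaD(1)[OF PT(1)] DeltaD(1)[OF PT(2)] by (auto simp: S_word_Cons S_elt_def)
qed

lemma S_word_path:
  assumes "A \<in> \<Delta>" "A \<subseteq> S_word L S w" "w \<in> lists (elts L)"
  shows "path A w (fold (conjg L) w ` A)"
  using assms
proof (induction w arbitrary: A)
  case (Cons g w)
  have g: "g \<in> elts L" and A: "A \<subseteq> S_elt L S g" "conjg L g ` A \<subseteq> S_word L S w"
    using Cons.prems by (auto simp: S_word_Cons)
  have s: "step A g (conjg L g ` A)"
    using step_restrict[OF S_elt_step[OF g] Cons.prems(1) A(1)] .
  then have "path (conjg L g ` A) w (fold (conjg L) w ` conjg L g ` A)"
    using Cons.IH[OF stepD(2)[OF s] A(2)] Cons.prems(3) by simp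
  then show ?case
    using path_Cons[OF s] by (simp add: image_image)
qed simp

text \<open>An object starting a chain for \<open>w\<close> lies in \<open>S_word L S w\<close>,
  which is therefore an object too and serves as a canonical start.\<close>

lemma Dom_S_word:
  assumes "w \<in> Dom L"
  shows "path (S_word L S w) w (fold (conjg L) w ` S_word L S w)"
proof -
  obtain P R where "path P w R"
    using Dom_path[OF assms] .
  moreover from this have "P \<in> \<Delta>"
    unfolding path_iff_chain by blast
  ultimately have "S_word L S w \<in> \<Delta>"
    using Delta_over[OF _ S_word_pg[OF Dom_elts[OF assms]] S_word_subset path_S_word] by blast
  then show ?thesis
    using S_word_path Dom_elts[OF assms] by blast
qed

text \<open>The agreement holds on the whole normalizer of the starting object; weak closure needs
  it outside the object itself.\<close>

lemma conj_prod_fold: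
  assumes "path P w R" "y \<in> pnormalizer L P"
  shows "conjg L (pprod L w) y = fold (conjg L) w y"
  using assms
proof (induction w arbitrary: P y)
  case Nil
  then show ?case
    using conj_one[of y] by (simp add: pnormalizer_def flip: pone_def)
next
  case (Cons g w)
  then obtain T where T: "step P g T" "path T w R"
    by auto
  have "conjg L (pprod L (g # w)) y = conjg L (pprod L w) (conjg L g y)"
    using conj_by_append[of "[g]" w y] path_conj_Dom[OF Cons.prems] stepD(3)[OF T(1)]
    by (simp add: prod_singleton)
  then show ?case
    using Cons.IH[OF T(2) normalizer_conj(2)[OF T(1) Cons.prems(2)]] by simp
qed

text \<open>Intersecting over all words forces invariance: if \<open>x\<close> survives
  \<open>g # w\<close> for every \<open>w\<close>, then its conjugate by \<open>g\<close> survives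
  every \<open>w\<close>. Conversely, a subgroup of \<open>S\<close> normalized by all elements
  stays in \<open>S\<close> along every word.\<close>

lemma O_p_largest_normal: "largest_normal L S (O_p L S)"
proof -
  have sub: "O_p L S \<subseteq> S"
    using S_word_Nil[of L S] unfolding O_p_def by blast
  have mem: "x \<in> O_p L S \<longleftrightarrow> (\<forall>w \<in> lists (elts L). x \<in> S_word L S w)" for x
    by (simp add: O_p_def)
  have "pg_subgroup L (O_p L S)"
  proof (rule pg_subgroup_of_S[OF sub])
    show "pone L \<in> O_p L S"
      using S_word_one mem by blast
    fix x assume x: "x \<in> O_p L S"
    then show "pinv L x \<in> O_p L S"
      using S_word_pinv mem by blast
    fix y assume "y \<in> O_p L S"
    then show "pprod L [x, y] \<in> O_p L S"
      using x S_word_mult mem by blast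
  qed
  moreover have "g \<in> pnormalizer L (O_p L S)" if g: "g \<in> elts L" for g
  proof (rule normalizer_mem_finite[OF g])
    have *: "x \<in> S_elt L S g \<and> conjg L g x \<in> S_word L S w" if "x \<in> O_p L S" "w \<in> lists (elts L)" for x w
    proof -
      have "g # w \<in> lists (elts L)"
        using g that(2) by simp
      then have "x \<in> S_word L S (g # w)"
        using that(1) mem by blast
      then show ?thesis
        by (simp add: S_word_Cons)
    qed
    show "O_p L S \<subseteq> conj_dom L g"
      using *[of _ "[]"] by (auto simp: S_elt_def)
    show "conjg L g ` O_p L S \<subseteq> O_p L S"
      using * mem by blast
    show "finite (O_p L S)"
      using sub finite_S finite_subset by blast
  qed
  moreover have "R \<subseteq> O_p L S" if R: "subgroup R (grp L S)" "pnormalizer L R = elts L" for R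
  proof -
    have RS: "R \<subseteq> S"
      using R(1) S_pg by (simp add: subgroup_grp_iff)
    have "x \<in> S_word L S w" if "w \<in> lists (elts L)" "x \<in> R" for x w
      using that
    proof (induction w arbitrary: x)
      case (Cons g w)
      then have "g \<in> pnormalizer L R"
        using R(2) by simp
      then have "x \<in> conj_dom L g" "conjg L g x \<in> R"
        using Cons.prems by (auto simp: pnormalizer_def)
      then show ?case
        using Cons RS by (auto simp: S_word_Cons S_elt_def)
    qed (use RS in auto)
    then show ?thesis
      using mem by blast
  qed
  ultimately show ?thesis
    using S_pg sub unfolding largest_normal_def by (auto simp: subgroup_grp_iff pnormalizer_def)
qed

section \<open>The fusion system of a locality\<close>

text \<open>An explicit model of the fusion system, which is defined as an intersection. Words
  outside \<open>Dom L\<close> are allowed, since a composite of conjugation maps need not come from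
  a single element.\<close>

definition word_homs :: "'a homsets" where
  "word_homs P R = {restrict (fold (conjg L) w) P | w. w \<in> lists (elts L) \<and> P \<subseteq> S_word L S w \<and>
    subgroup P (grp L S) \<and> subgroup R (grp L S) \<and> fold (conjg L) w ` P \<subseteq> R}"

lemma word_homsI:
  "w \<in> lists (elts L) \<Longrightarrow> P \<subseteq> S_word L S w \<Longrightarrow> subgroup P (grp L S) \<Longrightarrow> subgroup R (grp L S) \<Longrightarrow>
    fold (conjg L) w ` P \<subseteq> R \<Longrightarrow> restrict (fold (conjg L) w) P \<in> word_homs P R"
  unfolding word_homs_def by blast

lemma word_homsE:
  assumes "\<phi> \<in> word_homs P R"
  obtains w where "\<phi> = restrict (fold (conjg L) w) P" "w \<in> lists (elts L)" "P \<subseteq> S_word L S w"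
    "subgroup P (grp L S)" "subgroup R (grp L S)" "fold (conjg L) w ` P \<subseteq> R"
  using assms unfolding word_homs_def by blast

text \<open>Concatenation of words gives composites, \<open>winv L w\<close> gives inverses, and
  one-letter words over \<open>S\<close> give the inner conjugations.\<close>

lemma fusion_system_word_homs: "fusion_system (grp L S) word_homs"
proof
  interpret group "grp L S"
    using S_pg by (rule group_grp)
  fix P R T :: "'a set" and \<phi> \<psi> :: "'a \<Rightarrow> 'a"
  show "word_homs P R \<subseteq> inj_homs (grp L S) P R"
  proof
    fix \<phi> assume "\<phi> \<in> word_homs P R"
    then obtain w where w: "\<phi> = restrict (fold (conjg L) w) P" "w \<in> lists (elts L)" "P \<subseteq> S_word L S w"
      "subgroup P (grp L S)" "subgroup R (grp L S)" "fold (conjg L) w ` P \<subseteq> R"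
      by (rule word_homsE)
    have P: "pg_subgroup L P"
      using w(4) S_pg by (simp add: subgroup_grp_iff)
    have "\<phi> \<in> hom (grp L S\<lparr>carrier := P\<rparr>) (grp L S\<lparr>carrier := R\<rparr>)"
    proof (rule homI)
      fix x y assume "x \<in> carrier (grp L S\<lparr>carrier := P\<rparr>)" "y \<in> carrier (grp L S\<lparr>carrier := P\<rparr>)"
      then have "x \<in> P" "y \<in> P"
        by simp_all
      then show "\<phi> (x \<otimes>\<^bsub>grp L S\<lparr>carrier := P\<rparr>\<^esub> y) = \<phi> x \<otimes>\<^bsub>grp L S\<lparr>carrier := R\<rparr>\<^esub> \<phi> y"
        using S_word_mult[OF w(2), of x y] w(3) pg_subgroupD(5)[OF P] by (simp add: w(1) subset_iff)
    qed (use w(6) in \<open>auto simp: w(1)\<close>)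
    moreover have "inj_on \<phi> P"
      using inj_on_subset[OF inj_on_fold_conj[OF w(2)] w(3)] by (simp add: w(1))
    ultimately show "\<phi> \<in> inj_homs (grp L S) P R"
      using w(4,5) by (simp add: inj_homs_def w(1))
  qed
  show "conj_homs (grp L S) P R \<subseteq> word_homs P R"
  proof
    fix \<phi> assume "\<phi> \<in> conj_homs (grp L S) P R"
    then obtain s where s: "s \<in> S" "\<phi> = restrict (\<lambda>x. inv\<^bsub>grp L S\<^esub> s \<otimes>\<^bsub>grp L S\<^esub> x \<otimes>\<^bsub>grp L S\<^esub> s) P"
      and inj: "\<phi> \<in> inj_homs (grp L S) P R"
      by (auto simp: conj_homs_def)
    from inj have PR: "subgroup P (grp L S)" "subgroup R (grp L S)" "\<phi> ` P \<subseteq> R"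
      by (auto simp: inj_homs_def hom_def)
    have PS: "P \<subseteq> S"
      using PR(1) S_pg by (simp add: subgroup_grp_iff)
    have eq: "\<phi> = restrict (fold (conjg L) [s]) P"
      unfolding s(2) using conj_grp(2)[OF S_pg s(1)] PS by (intro restrict_ext) auto
    have "P \<subseteq> S_word L S [s]"
      using conj_grp(1,3)[OF S_pg s(1)] PS by (auto simp: S_word_Cons S_elt_def)
    then show "\<phi> \<in> word_homs P R"
      unfolding eq using PR s(1) S_elts eq by (intro word_homsI) auto
  qed
  show "compose P \<psi> \<phi> \<in> word_homs P T" if \<phi>: "\<phi> \<in> word_homs P R" and \<psi>: "\<psi> \<in> word_homs R T"
  proof -
    obtain u where u: "\<phi> = restrict (fold (conjg L) u) P" "u \<in> lists (elts L)" "P \<subseteq> S_word L S u"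
      "subgroup P (grp L S)" "subgroup R (grp L S)" "fold (conjg L) u ` P \<subseteq> R"
      using \<phi> by (rule word_homsE)
    obtain v where v: "\<psi> = restrict (fold (conjg L) v) R" "v \<in> lists (elts L)" "R \<subseteq> S_word L S v"
      "subgroup R (grp L S)" "subgroup T (grp L S)" "fold (conjg L) v ` R \<subseteq> T"
      using \<psi> by (rule word_homsE)
    have "compose P \<psi> \<phi> = restrict (fold (conjg L) (u @ v)) P"
      using u(6) by (auto simp: compose_def u(1) v(1) intro!: restrict_ext)
    moreover have "restrict (fold (conjg L) (u @ v)) P \<in> word_homs P T"
    proof (rule word_homsI)
      show "P \<subseteq> S_word L S (u @ v)"
        using u(3,6) v(3) by (simp add: S_word_append subset_iff image_subset_iff)
      show "fold (conjg L) (u @ v) ` P \<subseteq> T"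
        using u(6) v(6) by auto
    qed (use u v in simp_all)
    ultimately show ?thesis
      by simp
  qed
  show "\<phi> \<in> word_homs P (\<phi> ` P) \<and> restrict (inv_into P \<phi>) (\<phi> ` P) \<in> word_homs (\<phi> ` P) P"
    if \<phi>: "\<phi> \<in> word_homs P R"
  proof -
    obtain w where w: "\<phi> = restrict (fold (conjg L) w) P" "w \<in> lists (elts L)" "P \<subseteq> S_word L S w"
      "subgroup P (grp L S)" "subgroup R (grp L S)" "fold (conjg L) w ` P \<subseteq> R"
      using \<phi> by (rule word_homsE)
    let ?c = "fold (conjg L) w" and ?d = "fold (conjg L) (winv L w)"
    have im: "\<phi> ` P = ?c ` P"
      by (simp add: w(1))
    have "pg_subgroup L (?c ` P)" "?c ` P \<subseteq> S"
      using fold_conj_pg[OF w(2) _ w(3)] w(4) S_pg image_subsetI[OF fold_conj_S_word[OF subsetD[OF w(3)]]]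
      by (simp_all add: subgroup_grp_iff)
    then have sub: "subgroup (?c ` P) (grp L S)"
      using S_pg by (simp add: subgroup_grp_iff)
    have winv: "?c x \<in> S_word L S (winv L w)" "?d (?c x) = x" if "x \<in> P" for x
      using fold_conj_winv[OF w(2)] w(3) that by blast+
    have "inj_on ?c P"
      using inj_on_fold_conj[OF w(2)] w(3) by (rule inj_on_subset)
    then have "inj_on \<phi> P"
      by (simp add: w(1))
    then have "inv_into P \<phi> (?c x) = x" if "x \<in> P" for x
      using that inv_into_f_f[of \<phi> P x] by (simp add: w(1))
    then have eq: "restrict (inv_into P \<phi>) (\<phi> ` P) = restrict ?d (?c ` P)"
      using winv(2) unfolding im by (intro restrict_ext) auto
    have "restrict ?d (?c ` P) \<in> word_homs (?c ` P) P"
    proof (rule word_homsI)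
      show "winv L w \<in> lists (elts L)"
        using w(2) by (rule winv_lists)
      show "?c ` P \<subseteq> S_word L S (winv L w)" "?d ` ?c ` P \<subseteq> P"
        using winv by auto
    qed (use sub w(4) in simp_all)
    moreover have "\<phi> \<in> word_homs P (?c ` P)"
      unfolding w(1) using w sub by (intro word_homsI) simp_all
    ultimately show ?thesis
      using eq im by simp
  qed
qed

text \<open>An inclusion is conjugation by the neutral element, so it is among the
  \<open>conj_homs\<close>.\<close>

lemma fusion_system_inclusion:
  assumes "fusion_system (grp L S) F" "subgroup P (grp L S)" "subgroup R (grp L S)" "P \<subseteq> R"
  shows "restrict (\<lambda>x. x) P \<in> F P R"
proof -
  interpret group "grp L S"
    using S_pg by (rule group_grp)
  have P: "P \<subseteq> S" "pg_subgroup L P"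
    using assms(2) S_pg by (simp_all add: subgroup_grp_iff)
  have "restrict (\<lambda>x. x) P \<in> inj_homs (grp L S) P R"
    using assms(2-4) pg_subgroupD(5)[OF P(2)] by (auto simp: inj_homs_def hom_def)
  moreover have "restrict (\<lambda>x. x) P =
      restrict (\<lambda>x. inv\<^bsub>grp L S\<^esub> \<one>\<^bsub>grp L S\<^esub> \<otimes>\<^bsub>grp L S\<^esub> x \<otimes>\<^bsub>grp L S\<^esub> \<one>\<^bsub>grp L S\<^esub>) P"
  proof (rule restrict_ext)
    fix x assume "x \<in> P"
    then have "x \<in> carrier (grp L S)"
      using P by auto
    then show "x = inv\<^bsub>grp L S\<^esub> \<one>\<^bsub>grp L S\<^esub> \<otimes>\<^bsub>grp L S\<^esub> x \<otimes>\<^bsub>grp L S\<^esub> \<one>\<^bsub>grp L S\<^esub>"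
      by (simp only: inv_one l_one r_one)
  qed
  ultimately have "restrict (\<lambda>x. x) P \<in> conj_homs (grp L S) P R"
    using one_closed unfolding conj_homs_def by blast
  then show ?thesis
    using fusion_system.conj[OF assms(1)] by blast
qed

text \<open>The generators live on the full groups \<open>S_elt L S g\<close>. Each letter is first
  restricted along an inclusion, and its target is then cut down to the image before the rest of the
  word is composed with it.\<close>

lemma word_homs_minimal:
  assumes F: "fusion_system (grp L S) F"
    and gen: "\<And>g. g \<in> elts L \<Longrightarrow> restrict (conjg L g) (S_elt L S g) \<in> F (S_elt L S g) S"
  shows "word_homs P R \<subseteq> F P R"
proof
  have main: "restrict (fold (conjg L) w) P \<in> F P R" if "w \<in> lists (elts L)" "P \<subseteq> S_word L S w"
    "subgroup P (grp L S)" "subgroup R (grp L S)" "fold (conjg L) w ` P \<subseteq> R" for w P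
    using that
  proof (induction w arbitrary: P rule: list.induct)
    case Nil
    then have "P \<subseteq> R"
      by simp
    then have "restrict id P \<in> F P R"
      unfolding id_def using fusion_system_inclusion[OF F Nil.prems(3,4)] by blast
    then show ?case
      unfolding fold_Nil .
  next
    case (Cons g w)
    have g: "g \<in> elts L" and P: "P \<subseteq> S_elt L S g" and Pw: "conjg L g ` P \<subseteq> S_word L S w"
      using Cons.prems(1,2) by (auto simp: S_word_Cons)
    have sub: "subgroup (S_elt L S g) (grp L S)"
      using S_elt_pg[OF g] S_pg by (auto simp: subgroup_grp_iff S_elt_def)
    have Ppg: "pg_subgroup L P"
      using Cons.prems(3) S_pg by (simp add: subgroup_grp_iff)
    have "compose P (restrict (conjg L g) (S_elt L S g)) (restrict (\<lambda>x. x) P) \<in> F P S"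
      using fusion_system.comp[OF F fusion_system_inclusion[OF F Cons.prems(3) sub P] gen[OF g]] .
    also have "compose P (restrict (conjg L g) (S_elt L S g)) (restrict (\<lambda>x. x) P) = restrict (conjg L g) P"
      using P by (auto simp: compose_def intro!: restrict_ext)
    finally have c: "restrict (conjg L g) P \<in> F P (conjg L g ` P)"
      using fusion_system.factor[OF F] by (metis image_restrict_eq)
    have "conjg L g ` P \<subseteq> S"
      using Pw S_word_subset[of L S w] by blast
    then have "subgroup (conjg L g ` P) (grp L S)"
      using S_elt_conj_pg[OF g Ppg P] S_pg by (simp add: subgroup_grp_iff)
    then have "restrict (fold (conjg L) w) (conjg L g ` P) \<in> F (conjg L g ` P) R"
      using Pw Cons.prems by (intro Cons.IH) (simp_all add: image_image)
    from fusion_system.comp[OF F c this]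
    have "compose P (restrict (fold (conjg L) w) (conjg L g ` P)) (restrict (conjg L g) P) \<in> F P R" .
    also have "compose P (restrict (fold (conjg L) w) (conjg L g ` P)) (restrict (conjg L g) P) =
        restrict (fold (conjg L) (g # w)) P"
      by (auto simp: compose_def intro!: restrict_ext)
    finally show ?case .
  qed
  fix \<phi> assume "\<phi> \<in> word_homs P R"
  then show "\<phi> \<in> F P R"
    by (rule word_homsE) (use main in blast)
qed

lemma fusion_system_of_eq: "fusion_system_of L S = word_homs"
proof (intro ext equalityI)
  fix P R
  have "restrict (conjg L g) (S_elt L S g) \<in> word_homs (S_elt L S g) S" if g: "g \<in> elts L" for g
  proof -
    have eq: "fold (conjg L) [g] = conjg L g"
      by auto
    have subs: "subgroup (S_elt L S g) (grp L S)" "subgroup S (grp L S)"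
      using S_elt_pg[OF g] S_pg by (auto simp: subgroup_grp_iff S_elt_def)
    have "restrict (fold (conjg L) [g]) (S_elt L S g) \<in> word_homs (S_elt L S g) S"
      using g subs by (intro word_homsI) (auto simp: S_word_Cons S_elt_def)
    then show ?thesis
      unfolding eq .
  qed
  then show "fusion_system_of L S P R \<subseteq> word_homs P R"
    using fusion_system_word_homs unfolding fusion_system_of_def generated_fusion_system_def
    by (intro Inter_lower CollectI exI[of _ word_homs]) auto
  show "word_homs P R \<subseteq> fusion_system_of L S P R"
    unfolding fusion_system_of_def generated_fusion_system_def
  proof (rule Inter_greatest, elim CollectE exE conjE)
    fix X F assume F: "X = F P R" "fusion_system (grp L S) F"
      and gen: "\<forall>(X, Y, \<phi>) \<in> {(S_elt L S g, S, restrict (conjg L g) (S_elt L S g)) | g. g \<in> elts L}. \<phi> \<in> F X Y"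
    have "restrict (conjg L g) (S_elt L S g) \<in> F (S_elt L S g) S" if "g \<in> elts L" for g
      using bspec[OF gen, of "(S_elt L S g, S, restrict (conjg L g) (S_elt L S g))"] that by blast
    then show "word_homs P R \<subseteq> X"
      using word_homs_minimal[OF F(2)] F(1) by blast
  qed
qed

end

section \<open>Large subgroups\<close>

context partial_group
begin

lemma conj_grp_mult:
  assumes "pg_subgroup L N" "x \<in> N" "y \<in> N" "a \<in> N"
  shows "conjg L (pprod L [x, y]) a = conjg L y (conjg L x a)"
proof -
  note N = pg_subgroupD[OF assms(1)]
  have "winv L ([x] @ [y]) @ [a] @ [x] @ [y] \<in> lists N"
    using assms N(3) by simp
  then have "winv L ([x] @ [y]) @ [a] @ [x] @ [y] \<in> Dom L"
    using N(2) by blast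
  from conj_by_append[OF this] show ?thesis
    using assms N(1) by (simp add: prod_singleton subset_iff)
qed

text \<open>Needed for sets that are not objects: their normalizer in \<open>L\<close> need not be a
  group, but its part inside a group \<open>N\<close> is one.\<close>

lemma normalizer_in_group_pg:
  assumes "pg_subgroup L N" "A \<subseteq> N" "finite A"
  shows "pg_subgroup L (N \<inter> pnormalizer L A)"
  unfolding pg_subgroup_iff
proof (intro conjI ballI)
  note N = pg_subgroupD[OF assms(1)]
  note iff = mem_normalizer_in_group_iff[OF assms(1) _ assms(2,3)]
  show "N \<inter> pnormalizer L A \<subseteq> elts L" "lists (N \<inter> pnormalizer L A) \<subseteq> Dom L"
    using N(1) subset_trans[OF lists_mono[OF Int_lower1] N(2)] by auto
  have "conjg L (pone L) ` A \<subseteq> A"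
    using conj_one assms(2) N(1) by (auto simp: subset_iff)
  then show "pone L \<in> N \<inter> pnormalizer L A"
    using N(4) iff by simp
  fix x assume x: "x \<in> N \<inter> pnormalizer L A"
  then have A: "A \<subseteq> conj_dom L x" "conjg L x ` A = A"
    by (auto simp: pnormalizer_def)
  have "conjg L (pinv L x) a \<in> A" if a: "a \<in> A" for a
  proof -
    obtain b where "b \<in> A" "a = conjg L x b"
      using A(2) a by blast
    then show ?thesis
      using conj_inv_cancel(2) A(1) by (simp add: subset_iff)
  qed
  then show "pinv L x \<in> N \<inter> pnormalizer L A"
    using x N(3) iff[of "pinv L x"] by auto
  fix y assume y: "y \<in> N \<inter> pnormalizer L A"
  then have "conjg L y ` A = A"
    by (auto simp: pnormalizer_def)
  moreover have "conjg L (pprod L [x, y]) ` A = conjg L y ` conjg L x ` A"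
    using conj_grp_mult[OF assms(1), of x y] x y assms(2) by (auto simp: image_image subset_iff)
  ultimately show "pprod L [x, y] \<in> N \<inter> pnormalizer L A"
    using x y N(5) iff[of "pprod L [x, y]"] A(2) by auto
qed

lemma conj_grp_eq:
  assumes "pg_subgroup L N" "x \<in> N" "y \<in> N"
  shows "conjg L x y = pprod L [pprod L [pinv L x, y], x]"
  using conj_grp(2)[OF assms] inv_grp[OF assms(1,2)] by simp

end

context locality
begin

text \<open>Conjugation by \<open>g\<close> is a homomorphism between the two normalizers, so it
  respects conjugation inside them. Statements about normalizing are transported along
  \<open>g\<close> by this identity.\<close>

lemma normalizer_conj_conj:
  assumes "step P g R" "x \<in> pnormalizer L P" "y \<in> pnormalizer L P"
  shows "conjg L (conjg L g x) (conjg L g y) = conjg L g (conjg L x y)"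
proof -
  have N: "pg_subgroup L (pnormalizer L P)" "pg_subgroup L (pnormalizer L R)"
    using normalizer_pg stepD[OF assms(1)] by auto
  note m = normalizer_conj_mult[OF assms(1)]
  have "conjg L g (conjg L x y) = pprod L [pprod L [conjg L g (pinv L x), conjg L g y], conjg L g x]"
    using assms(2,3) pg_subgroupD(3,5)[OF N(1)] by (simp add: conj_grp_eq[OF N(1)] m)
  also have "conjg L g (pinv L x) = pinv L (conjg L g x)"
    using conj_pinv(2) normalizer_conj(1)[OF assms(1,2)] by blast
  finally show ?thesis
    using normalizer_conj(2)[OF assms(1)] assms(2,3) by (simp add: conj_grp_eq[OF N(2)])
qed

section \<open>Large subgroups and the centre of S\<close>

lemma largeD:
  assumes "large L S Q"
  shows "Q \<subseteq> S" "pg_subgroup L Q" "finite Q" "pcentralizer L Q \<subseteq> Q"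
    "pg_subgroup L U \<Longrightarrow> U \<subseteq> group_center L Q \<Longrightarrow> U \<noteq> {pone L} \<Longrightarrow> pnormalizer L U \<subseteq> pnormalizer L Q"
proof -
  show Q: "Q \<subseteq> S" "pg_subgroup L Q"
    using assms S_pg by (simp_all add: large_def subgroup_grp_iff)
  then show "finite Q"
    using finite_S finite_subset by blast
  show "pg_subgroup L U \<Longrightarrow> U \<subseteq> group_center L Q \<Longrightarrow> U \<noteq> {pone L} \<Longrightarrow> pnormalizer L U \<subseteq> pnormalizer L Q"
    using assms subgroup_grp_iff[OF group_center_subgroup[OF Q(2)]] by (simp add: large_def)
qed (use assms in \<open>simp add: large_def\<close>)

lemma largeI:
  assumes "Q \<subseteq> S" "pg_subgroup L Q" "pcentralizer L Q \<subseteq> Q"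
    "\<And>U. pg_subgroup L U \<Longrightarrow> U \<subseteq> group_center L Q \<Longrightarrow> U \<noteq> {pone L} \<Longrightarrow> pnormalizer L U \<subseteq> pnormalizer L Q"
  shows "large L S Q"
  using assms S_pg subgroup_grp_iff[OF group_center_subgroup[OF assms(2)]]
  by (simp add: large_def subgroup_grp_iff)

text \<open>Membership in \<open>pcentralizer L Q\<close> also requires the conjugates to be
  defined, which the ambient group \<open>N\<close> guarantees. It is applied with \<open>S\<close>
  and with the normalizer of an object as \<open>N\<close>.\<close>

lemma large_contains_commuting:
  assumes "large L S Q" "pg_subgroup L N" "Q \<subseteq> N" "y \<in> N" "\<And>x. x \<in> Q \<Longrightarrow> pprod L [x, y] = pprod L [y, x]"
  shows "y \<in> Q"
proof -
  have "conjg L y x = x \<and> x \<in> conj_dom L y" if "x \<in> Q" for x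
    using conj_eq_iff_commute[OF assms(2,4)] conj_grp(1)[OF assms(2,4)] assms(3,5) that by blast
  then have "y \<in> pcentralizer L Q"
    using assms(4) pg_subgroupD(1)[OF assms(2)] by (auto simp: pcentralizer_def)
  then show ?thesis
    using largeD(4)[OF assms(1)] by blast
qed

lemma center_S_subset_large:
  assumes "large L S Q"
  shows "group_center L S \<subseteq> group_center L Q"
proof
  fix z assume "z \<in> group_center L S"
  then have z: "z \<in> S" "\<And>x. x \<in> S \<Longrightarrow> pprod L [z, x] = pprod L [x, z]"
    unfolding group_center_def by blast+
  have comm: "pprod L [x, z] = pprod L [z, x]" if "x \<in> Q" for x
    using z(2)[of x] largeD(1)[OF assms] that by auto
  then have "z \<in> Q"
    using large_contains_commuting[OF assms S_pg largeD(1)[OF assms] z(1)] by blast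
  then show "z \<in> group_center L Q"
    using comm unfolding group_center_def by auto
qed

lemma S_normalizes_large:
  assumes "large L S Q"
  shows "S \<subseteq> pnormalizer L Q"
proof (cases "S = {pone L}")
  \<comment> \<open>The centre of \<open>S\<close> is trivial here, and largeness says nothing about
    it.\<close>
  case True
  then have "Q = S"
    using largeD(1)[OF assms] pg_subgroupD(4)[OF largeD(2)[OF assms]] by blast
  then show ?thesis
    using subset_normalizer[OF S_pg finite_S] by simp
next
  case False
  let ?Z = "group_center L S"
  have Z: "?Z \<subseteq> S" "finite ?Z"
    using finite_S by (auto simp: group_center_def)
  have "s \<in> pnormalizer L ?Z" if s: "s \<in> S" for s
  proof -
    have "conjg L s z = z" if z: "z \<in> ?Z" for z
    proof -
      have "z \<in> S" "pprod L [z, s] = pprod L [s, z]"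
        using z s unfolding group_center_def by blast+
      then show ?thesis
        using conj_eq_iff_commute[OF S_pg s] by blast
    qed
    then show ?thesis
      using mem_normalizer_in_group_iff[OF S_pg s Z] by auto
  qed
  moreover have "pnormalizer L ?Z \<subseteq> pnormalizer L Q"
    using largeD(5)[OF assms group_center_subgroup[OF S_pg] center_S_subset_large[OF assms]]
      group_center_nontrivial[OF prime_p S_p_subgroup False] by blast
  ultimately show ?thesis
    by blast
qed

lemma large_normal:
  assumes "large L S Q"
  shows "Q \<lhd> grp L S"
proof -
  interpret group "grp L S"
    using S_pg by (rule group_grp)
  have sub: "subgroup Q (grp L S)"
    using largeD(1,2)[OF assms] S_pg by (simp add: subgroup_grp_iff)
  have "x \<otimes>\<^bsub>grp L S\<^esub> h \<otimes>\<^bsub>grp L S\<^esub> inv\<^bsub>grp L S\<^esub> x \<in> Q" if x: "x \<in> carrier (grp L S)" and h: "h \<in> Q" for x h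
  proof -
    have xS: "x \<in> S" and xi: "pinv L x \<in> S" "x \<in> elts L" and hS: "h \<in> S"
      using x h pg_subgroupD(1,3)[OF S_pg] largeD(1)[OF assms] by auto
    \<comment> \<open>Normality is checked on \<open>x h inv x\<close>, which is
      \<open>conjg\<close> by the inverse of \<open>x\<close>.\<close>
    have "conjg L (pinv L x) h \<in> Q"
      using S_normalizes_large[OF assms] xi(1) h by (auto simp: pnormalizer_def)
    then show ?thesis
      using conj_grp_eq[OF S_pg xi(1) hS] inv_grp[OF S_pg xS] partial_group.inv_inv[OF partial_group_axioms xi(2)] by simp
  qed
  then show ?thesis
    using sub by (simp only: normal_inv_iff) blast
qed

section \<open>Weak closure\<close>

lemma large_weakly_closed_full:
  assumes "large L S Q" "S \<noteq> {pone L}" "f \<in> elts L" "S_elt L S f = S"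
  shows "conjg L f ` Q = Q"
proof -
  let ?Z = "group_center L S"
  have dom: "S \<subseteq> conj_dom L f" and im: "conjg L f ` S \<subseteq> S"
    using assms(4) unfolding S_elt_def by auto
  have surj: "conjg L f ` S = S"
    using endo_inj_surj[OF finite_S im inj_on_subset[OF inj_on_conj dom]] .
  \<comment> \<open>\<open>f\<close> induces an automorphism of \<open>S\<close>, which preserves
    the centre. So \<open>f\<close> normalizes a nontrivial subgroup of the centre of
    \<open>Q\<close>.\<close>
  have "conjg L f z \<in> ?Z" if "z \<in> ?Z" for z
  proof -
    have z: "z \<in> S" "\<And>x. x \<in> S \<Longrightarrow> pprod L [z, x] = pprod L [x, z]"
      using that unfolding group_center_def by blast+
    have "pprod L [conjg L f z, x] = pprod L [x, conjg L f z]" if x: "x \<in> S" for x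
    proof -
      obtain y where y: "y \<in> S" "x = conjg L f y"
        using surj x by blast
      show ?thesis
        using S_elt_mult(2)[OF assms(3), of z y] S_elt_mult(2)[OF assms(3), of y z] assms(4) z(1)
          z(2)[OF y(1)] y by simp
    qed
    moreover have "conjg L f z \<in> S"
      using im z(1) by blast
    ultimately show ?thesis
      unfolding group_center_def by blast
  qed
  moreover have "?Z \<subseteq> S"
    by (auto simp: group_center_def)
  ultimately have "f \<in> pnormalizer L ?Z"
    using dom finite_S finite_subset by (intro normalizer_mem_finite[OF assms(3)]) blast+
  then have "f \<in> pnormalizer L Q"
    using largeD(5)[OF assms(1) group_center_subgroup[OF S_pg] center_S_subset_large[OF assms(1)]]
      group_center_nontrivial[OF prime_p S_p_subgroup assms(2)] by blast
  then show ?thesis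
    by (simp add: pnormalizer_def)
qed

text \<open>The image of \<open>Q\<close> is not known to be large, so the question is moved to
  \<open>Q\<close>: the centre of \<open>S\<close> and the element \<open>r\<close> are pulled back
  along \<open>f\<close>, largeness of \<open>Q\<close> is applied there, and the answer is carried
  forward again.\<close>

lemma S_normalizes_conj_large:
  assumes "large L S Q" "S \<noteq> {pone L}" and s: "step P f R" and "Q \<subseteq> P"
    and r: "r \<in> S" "r \<in> pnormalizer L R"
  shows "conjg L r ` conjg L f ` Q \<subseteq> conjg L f ` Q"
proof -
  let ?Z = "group_center L S" and ?g = "pinv L f"
  note f = stepD[OF s]
  have s': "step R ?g P"
    using step_inv[OF s] .
  have N: "pg_subgroup L (pnormalizer L P)" "pg_subgroup L (pnormalizer L R)"
    using normalizer_pg f by auto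
  have PN: "P \<subseteq> pnormalizer L P" and RN: "R \<subseteq> pnormalizer L R"
    using subset_normalizer DeltaD[OF f(1)] DeltaD[OF f(2)] by auto
  have QN: "Q \<subseteq> pnormalizer L P"
    using assms(4) PN by blast
  have fg: "conjg L ?g (conjg L f x) = x" if "x \<in> pnormalizer L P" for x
    using conj_inv_cancel(2) normalizer_conj(1)[OF s that] by blast
  have gf: "conjg L f (conjg L ?g x) = x" if "x \<in> pnormalizer L R" for x
    using conj_inv_cancel'(2)[OF normalizer_conj(1)[OF s' that] f(3)] .
  have Z: "?Z \<subseteq> S" "\<And>z x. z \<in> ?Z \<Longrightarrow> x \<in> S \<Longrightarrow> pprod L [z, x] = pprod L [x, z]"
    unfolding group_center_def by blast+
  have conjZ: "conjg L z x = x" "conjg L x z = z" if "z \<in> ?Z" "x \<in> S" for z x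
    using conj_eq_iff_commute[OF S_pg] Z that by (metis subsetD)+
  \<comment> \<open>The centre centralizes \<open>R\<close>, since \<open>R\<close> lies in
    \<open>S\<close>; so it belongs to the group on which conjugation by \<open>?g\<close> is
    defined.\<close>
  have ZN: "?Z \<subseteq> pnormalizer L R"
  proof
    fix z assume z: "z \<in> ?Z"
    then have "conjg L z ` R = R"
      using conjZ(1)[OF z] DeltaD(1)[OF f(2)] by (auto simp: subset_iff)
    then show "z \<in> pnormalizer L R"
      using mem_normalizer_in_group_iff[OF S_pg _ DeltaD(1,3)[OF f(2)]] z Z(1) by auto
  qed
  have fQ: "conjg L f x \<in> S" "conjg L f x \<in> pnormalizer L R" if "x \<in> Q" for x
    using that f(5) assms(4) RN DeltaD(1)[OF f(2)] by blast+
  \<comment> \<open>The centre of \<open>S\<close> commutes with the image of \<open>Q\<close>, so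
    \<open>U\<close> commutes with \<open>Q\<close>. The centralizer condition puts \<open>U\<close>
    into \<open>Q\<close>, hence into its centre.\<close>
  define U where "U = conjg L ?g ` ?Z"
  have U_N: "U \<subseteq> pnormalizer L P" and Upg: "pg_subgroup L U"
    using conj_pg_subgroup[OF s' group_center_subgroup[OF S_pg] ZN] by (auto simp: U_def)
  have comm: "pprod L [x, u] = pprod L [u, x]" if x: "x \<in> Q" and u: "u \<in> U" for x u
  proof -
    obtain z where z: "z \<in> ?Z" "u = conjg L ?g z"
      using u by (auto simp: U_def)
    have zx: "z \<in> pnormalizer L R" "conjg L ?g (conjg L f x) = x"
      using ZN z(1) fg[of x] QN x by blast+
    have "pprod L [u, x] = conjg L ?g (pprod L [z, conjg L f x])"
      using normalizer_conj_mult[OF s', of z "conjg L f x"] z(2) zx fQ(2)[OF x] by simp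
    also have "\<dots> = conjg L ?g (pprod L [conjg L f x, z])"
      using Z(2)[OF z(1) fQ(1)[OF x]] by simp
    also have "\<dots> = pprod L [x, u]"
      using normalizer_conj_mult[OF s', of "conjg L f x" z] z(2) zx fQ(2)[OF x] by simp
    finally show ?thesis
      by simp
  qed
  have "U \<subseteq> group_center L Q"
  proof
    fix u assume u: "u \<in> U"
    then have "u \<in> Q"
      using large_contains_commuting[OF assms(1) N(1) QN] U_N comm by blast
    then show "u \<in> group_center L Q"
      using comm[OF _ u, symmetric] unfolding group_center_def by blast
  qed
  moreover have "U \<noteq> {pone L}"
  proof
    assume U1: "U = {pone L}"
    have "z = pone L" if "z \<in> ?Z" for z
    proof -
      have "conjg L ?g z = pone L"
        using U1 that unfolding U_def by blast
      then show ?thesis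
        using gf[of z] ZN that one_conj[OF f(3)] by auto
    qed
    then show False
      using group_center_nontrivial[OF prime_p S_p_subgroup assms(2)]
        pg_subgroupD(4)[OF group_center_subgroup[OF S_pg]] by blast
  qed
  ultimately have UQ: "pnormalizer L U \<subseteq> pnormalizer L Q"
    using largeD(5)[OF assms(1) Upg] by blast
  \<comment> \<open>Since \<open>r\<close> centralizes the centre of \<open>S\<close>, its pullback
    centralizes \<open>U\<close> and therefore normalizes \<open>Q\<close>.\<close>
  define r' where "r' = conjg L ?g r"
  have r': "r' \<in> pnormalizer L P" "conjg L f r' = r"
    using normalizer_conj(2)[OF s' r(2)] gf[OF r(2)] by (simp_all add: r'_def)
  have "conjg L r' u = u" if u: "u \<in> U" for u
  proof -
    obtain z where z: "z \<in> ?Z" "u = conjg L ?g z"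
      using u by (auto simp: U_def)
    then show ?thesis
      using normalizer_conj_conj[OF s' r(2), of z] ZN conjZ(2)[OF z(1) r(1)] by (auto simp: r'_def)
  qed
  moreover have "finite U"
    unfolding U_def using Z(1) finite_S finite_subset by blast
  ultimately have "r' \<in> pnormalizer L U"
    using mem_normalizer_in_group_iff[OF N(1) r'(1) U_N] by auto
  then have r'Q: "conjg L r' ` Q = Q"
    using UQ by (auto simp: pnormalizer_def)
  have "conjg L r (conjg L f x) = conjg L f (conjg L r' x)" if "x \<in> Q" for x
    using normalizer_conj_conj[OF s r'(1), of x] QN that r'(2) by auto
  then show ?thesis
    using r'Q by auto
qed

text \<open>Suppose \<open>f\<close> moves \<open>Q\<close> and \<open>S\<^sub>f\<close> is as large as possible; put \<open>P = S\<^sub>f\<close> and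
  \<open>R = P\<^sup>f\<close>.  Both \<open>N\<^sub>S(P)\<^sup>f\<close> and \<open>N\<^sub>S(R)\<close> normalize \<open>Q\<^sup>f\<close>, so Sylow's theorem in
  the normalizer of \<open>Q\<^sup>f\<close> in the group \<open>N\<^sub>L(R)\<close> gives \<open>h\<close> and then \<open>t\<close> such that
  both \<open>f h t\<close> and \<open>t\<close> conjugate these normalizers into \<open>S\<close>.  By maximality \<open>f h t\<close> and
  the inverse of \<open>t\<close> fix \<open>Q\<close>, hence so does \<open>f\<close>.\<close>

lemma large_weakly_closed_nontrivial:
  assumes large: "large L S Q" and S1: "S \<noteq> {pone L}"
    and "f \<in> elts L" and "Q \<subseteq> S_elt L S f"
  shows "conjg L f ` Q = Q"
  using assms(3,4)
proof (induction "card S - card (S_elt L S f)" arbitrary: f rule: less_induct)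
  case (less f)
  let ?P = "S_elt L S f"
  define R where "R = conjg L f ` ?P"
  have s: "step ?P f R"
    using S_elt_step[OF less.prems(1)] by (simp add: R_def)
  note f = stepD[OF s]
  show ?case
  proof (cases "?P = S")
    case True
    then show ?thesis
      using large_weakly_closed_full[OF large S1 less.prems(1)] by blast
  next
    case False
    have le: "card (S_elt L S g) \<le> card S" for g
      using finite_S by (intro card_mono) (auto simp: S_elt_def)
    have IH: "conjg L g ` Q = Q" if "g \<in> elts L" "Q \<subseteq> S_elt L S g" "card ?P < card (S_elt L S g)" for g
      using less.hyps[OF _ that(1,2)] that(3) le[of g] by (metis diff_less_mono2 less_le_trans)
    have P: "?P \<subseteq> S" "pg_subgroup L ?P" and R: "R \<subseteq> S" "pg_subgroup L R"
      using DeltaD f by auto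
    have cardPR: "card R = card ?P"
      unfolding R_def using inj_on_subset[OF inj_on_conj f(4)] by (rule card_image)
    have RS: "R \<noteq> S"
      using False P(1) cardPR finite_S card_subset_eq by metis
    let ?N = "pnormalizer L ?P" and ?N' = "pnormalizer L R"
    have N: "pg_subgroup L ?N" and N': "pg_subgroup L ?N'" and finN': "finite ?N'"
      using normalizer_pg f finite_subset[OF _ finite_elts] by (auto simp: pnormalizer_def)
    have PN: "?P \<subset> S \<inter> ?N"
      using P False by (intro p_subgroup_normalizer_grows[OF prime_p S_p_subgroup]) blast+
    have RN: "R \<subset> S \<inter> ?N'"
      using R RS by (intro p_subgroup_normalizer_grows[OF prime_p S_p_subgroup]) blast+
    define Q' where "Q' = conjg L f ` Q"
    have Q'R: "Q' \<subseteq> R" and finQ': "finite Q'"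
      using less.prems(2) largeD(3)[OF large] by (auto simp: Q'_def R_def)
    then have Q'N: "Q' \<subseteq> ?N'"
      using RN by blast
    \<comment> \<open>\<open>Q'\<close> need not be an object, so Sylow's theorem is applied to the
      part of its normalizer inside the group \<open>?N'\<close>; this also forces \<open>h\<close>
      to fix \<open>Q'\<close>.\<close>
    let ?H = "?N' \<inter> pnormalizer L Q'"
    have H: "pg_subgroup L ?H" "finite ?H"
      using normalizer_in_group_pg[OF N' Q'N finQ'] finN' by auto
    have Ap: "p_subgroup p L (S \<inter> ?N)" and Bp: "p_subgroup p L (S \<inter> ?N')"
      using p_subgroup_subset[OF prime_p S_p_subgroup] pg_subgroup_Int[OF S_pg] N N' by blast+
    have A: "p_subgroup p L (conjg L f ` (S \<inter> ?N))" "conjg L f ` (S \<inter> ?N) \<subseteq> ?N'"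
      using conj_p_subgroup(1)[OF s Ap] normalizer_conj(2)[OF s] by auto
    have "conjg L f ` (S \<inter> ?N) \<subseteq> pnormalizer L Q'"
    proof
      fix a assume "a \<in> conjg L f ` (S \<inter> ?N)"
      then obtain r where r: "r \<in> S" "r \<in> ?N" "a = conjg L f r"
        by blast
      have rQ: "conjg L r ` Q = Q"
        using S_normalizes_large[OF large] r(1) by (auto simp: pnormalizer_def)
      have "conjg L a (conjg L f x) = conjg L f (conjg L r x)" if "x \<in> Q" for x
        using normalizer_conj_conj[OF s r(2), of x] PN less.prems(2) that r(3) by auto
      then have "conjg L a ` Q' \<subseteq> Q'"
        using rQ by (auto simp: Q'_def)
      then show "a \<in> pnormalizer L Q'"
        using mem_normalizer_in_group_iff[OF N' _ Q'N finQ'] A(2) \<open>a \<in> _\<close> by blast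
    qed
    then have AH: "conjg L f ` (S \<inter> ?N) \<subseteq> ?H"
      using A(2) by blast
    \<comment> \<open>The image of \<open>S \<inter> ?N\<close> normalizes \<open>Q'\<close> just
      because \<open>S\<close> normalizes \<open>Q\<close>. For \<open>S \<inter> ?N'\<close> the
      pulled-back centre is needed.\<close>
    have "conjg L r ` Q' \<subseteq> Q'" if "r \<in> S \<inter> ?N'" for r
      unfolding Q'_def using S_normalizes_conj_large[OF large S1 s less.prems(2)] that by blast
    then have BH: "S \<inter> ?N' \<subseteq> ?H"
      using mem_normalizer_in_group_iff[OF N' _ Q'N finQ'] by blast
    obtain h T where h: "h \<in> ?H" and T: "p_subgroup p L T" "T \<subseteq> ?H" "S \<inter> ?N' \<subseteq> T"
      "conjg L h ` conjg L f ` (S \<inter> ?N) \<subseteq> T"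
      using p_subgroup_common_conj[OF prime_p H A(1) AH Bp BH] by blast
    have "R \<subseteq> T" "T \<subseteq> ?N'"
      using RN T(2,3) by blast+
    then obtain t R' where t: "step R t R'" "conjg L t ` T \<subseteq> S"
      using p_subgroup_conj_into_S[OF f(2) _ _ T(1)] by blast
    have hs: "step R h R"
      using h f(2) by (simp add: mem_normalizer_iff)
    have path: "path ?P [f, h, t] R'"
      using path_Cons[OF s path_Cons[OF hs path_single[OF t(1)]]] .
    define k where "k = pprod L [f, h, t]"
    have k: "step ?P k R'" and kconj: "conjg L k y = conjg L t (conjg L h (conjg L f y))" if "y \<in> ?N" for y
      using step_prod[OF path] conj_prod_fold[OF path that] by (simp_all add: k_def)
    \<comment> \<open>The fact \<open>k\<close> was obtained together with \<open>kconj\<close>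
      under the premise \<open>y \<in> ?N\<close>; the neutral element discharges it.\<close>
    have one_in: "pone L \<in> ?N"
      using pg_subgroupD(4)[OF N] .
    note k = k[OF one_in]
    have Nk: "S \<inter> ?N \<subseteq> S_elt L S k"
    proof
      fix y assume y: "y \<in> S \<inter> ?N"
      then have "conjg L k y \<in> S"
        using T(4) t(2) kconj[of y] by auto
      then show "y \<in> S_elt L S k"
        using y normalizer_conj(1)[OF k] by (auto simp: S_elt_def)
    qed
    have "card ?P < card (S \<inter> ?N)"
      using PN finite_S by (intro psubset_card_mono) auto
    also have "\<dots> \<le> card (S_elt L S k)"
      using Nk finite_S by (intro card_mono) (auto simp: S_elt_def intro: finite_subset)
    finally have "conjg L k ` Q = Q"
      using IH[OF stepD(3)[OF k]] Nk PN less.prems(2) by blast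
    moreover have "conjg L k ` Q = conjg L t ` Q'"
    proof -
      have "conjg L k ` Q = conjg L t ` conjg L h ` Q'"
        using kconj PN less.prems(2) by (auto simp: Q'_def image_image subset_iff)
      then show ?thesis
        using h by (auto simp: pnormalizer_def)
    qed
    ultimately have tQ: "conjg L t ` Q' = Q"
      by simp
    \<comment> \<open>The inverse of \<open>t\<close> takes \<open>Q\<close> to \<open>Q'\<close>.
      It falls under the induction hypothesis because \<open>R\<close> has the order of
      \<open>?P\<close> and \<open>S \<inter> ?N'\<close> is larger, so \<open>Q'\<close> equals
      \<open>Q\<close>.\<close>
    let ?g = "pinv L t"
    have g: "?g \<in> elts L"
      using stepD(3)[OF t(1)] by (rule inv_closed)
    have undo: "conjg L t y \<in> conj_dom L ?g" "conjg L ?g (conjg L t y) = y" if "y \<in> ?N'" for y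
      using conj_inv_cancel[OF normalizer_conj(1)[OF t(1) that]] by auto
    have Ng: "conjg L t ` (S \<inter> ?N') \<subseteq> S_elt L S ?g"
    proof -
      have "conjg L t ` (S \<inter> ?N') \<subseteq> S"
        using T(3) t(2) by blast
      then show ?thesis
        using undo by (auto simp: S_elt_def)
    qed
    have "card ?P < card (S \<inter> ?N')"
      using RN finite_S cardPR psubset_card_mono[of "S \<inter> ?N'" R] by auto
    also have "\<dots> = card (conjg L t ` (S \<inter> ?N'))"
      using conj_p_subgroup(2)[OF t(1) Bp] by simp
    also have "\<dots> \<le> card (S_elt L S ?g)"
      using Ng finite_S by (intro card_mono) (auto simp: S_elt_def intro: finite_subset)
    finally have "conjg L ?g ` Q = Q"
      using IH[OF g] Ng tQ Q'R RN by blast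
    moreover have "conjg L ?g ` Q = Q'"
      using tQ undo(2) Q'N by (auto simp: image_image subset_iff)
    ultimately show ?thesis
      by (simp add: Q'_def)
  qed
qed

lemma large_weakly_closed:
  assumes "large L S Q"
  shows "weakly_closed L S Q"
proof (cases "S = {pone L}")
  case True
  then have "Q = {pone L}"
    using largeD(1)[OF assms] pg_subgroupD(4)[OF largeD(2)[OF assms]] by blast
  then show ?thesis
    using one_conj by (simp add: weakly_closed_def)
next
  case False
  then show ?thesis
    using large_weakly_closed_nontrivial[OF assms] by (simp add: weakly_closed_def)
qed

end

section \<open>Partial subgroups as partial groups\<close>

lemma sub_pgroup_simps [simp]:
  "elts (sub_pgroup L H) = H" "Dom (sub_pgroup L H) = lists H \<inter> Dom L"
  "pprod (sub_pgroup L H) = pprod L" "pinv (sub_pgroup L H) = pinv L"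
  "winv (sub_pgroup L H) = winv L" "pone (sub_pgroup L H) = pone L"
  "conjg (sub_pgroup L H) = conjg L" "grp (sub_pgroup L H) = grp L"
  by (auto simp: sub_pgroup_def winv_def pone_def conjg_def grp_def fun_eq_iff)

lemma partial_group_sub_pgroup:
  assumes "partial_group L" "partial_subgroup L H" "H \<noteq> {}"
  shows "partial_group (sub_pgroup L H)"
proof -
  interpret partial_group L
    by fact
  have H: "H \<subseteq> elts L" "\<And>h. h \<in> H \<Longrightarrow> pinv L h \<in> H"
    "\<And>v. v \<in> lists H \<Longrightarrow> v \<in> Dom L \<Longrightarrow> pprod L v \<in> H"
    using assms(2) by (auto simp: partial_subgroup_def simp del: in_lists_conv_set)
  show ?thesis
  proof
    fix u v w
    assume "u @ v @ w \<in> Dom (sub_pgroup L H)"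
    then have D: "u @ v @ w \<in> Dom L" "u \<in> lists H" "v \<in> lists H" "w \<in> lists H"
      by auto
    have "v \<in> Dom L"
      using Dom_infix[OF D(1)] .
    then have "pprod L v \<in> H"
      using H(3) D(3) by blast
    then show "u @ [pprod (sub_pgroup L H) v] @ w \<in> Dom (sub_pgroup L H) \<and>
        pprod (sub_pgroup L H) (u @ v @ w) =
        pprod (sub_pgroup L H) (u @ [pprod (sub_pgroup L H) v] @ w)"
      using prod_infix[OF D(1)] D by simp
  next
    fix w assume "w \<in> Dom (sub_pgroup L H)"
    then have w: "w \<in> Dom L" "w \<in> lists H"
      by simp_all
    then have "winv L w \<in> lists H"
      using H(2) by (auto simp: winv_def)
    then show "winv (sub_pgroup L H) w @ w \<in> Dom (sub_pgroup L H) \<and>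
        pprod (sub_pgroup L H) (winv (sub_pgroup L H) w @ w) = pone (sub_pgroup L H)"
      using inv_word[OF w(1)] w(2) by simp
  next
    fix u v assume "u @ v \<in> Dom (sub_pgroup L H)"
    then show "u \<in> Dom (sub_pgroup L H) \<and> v \<in> Dom (sub_pgroup L H)"
      using Dom_split[of u v] by simp
  qed (use assms(3) H singleton_Dom prod_singleton inv_inv in auto)
qed

lemma conj_dom_sub_pgroup:
  assumes "f \<in> H" "\<And>h. h \<in> H \<Longrightarrow> pinv L h \<in> H" "H \<subseteq> elts L"
  shows "conj_dom (sub_pgroup L H) f = H \<inter> conj_dom L f"
  using assms by (auto simp: conj_dom_def)

lemma p_subgroup_sub_pgroup:
  "H \<subseteq> elts L \<Longrightarrow> p_subgroup p (sub_pgroup L H) T \<longleftrightarrow> T \<subseteq> H \<and> p_subgroup p L T"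
  by (auto simp: p_subgroup_def pg_subgroup_def partial_subgroup_def)

context locality
begin

text \<open>For a word \<open>v\<close> in the domain whose letters normalize \<open>Q\<close>, the
  group \<open>Q\<close> lies in the object \<open>S_word L S v\<close>. There conjugation by the
  product is the composite over the letters, each of which fixes \<open>Q\<close>.\<close>

lemma normalizer_partial_subgroup:
  assumes "Q \<subseteq> S" "S \<subseteq> pnormalizer L Q"
  shows "partial_subgroup L (pnormalizer L Q)"
  unfolding partial_subgroup_def
proof (intro conjI ballI)
  show "pnormalizer L Q \<subseteq> elts L"
    by (auto simp: pnormalizer_def)
  fix f assume "f \<in> pnormalizer L Q"
  then have f: "f \<in> elts L" "Q \<subseteq> conj_dom L f" "conjg L f ` Q = Q"
    by (auto simp: pnormalizer_def)
  have undo: "conjg L (pinv L f) (conjg L f x) = x" "conjg L f x \<in> conj_dom L (pinv L f)" if "x \<in> Q" for x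
    using conj_inv_cancel[of x f] f(2) that by blast+
  have "conjg L f ` Q \<subseteq> conj_dom L (pinv L f)" "conjg L (pinv L f) ` conjg L f ` Q = Q"
    using undo by (auto simp: image_image)
  then show "pinv L f \<in> pnormalizer L Q"
    using f inv_closed by (simp add: pnormalizer_def)
next
  fix v assume v: "v \<in> lists (pnormalizer L Q) \<inter> Dom L"
  have "A \<subseteq> S_word L S v \<and> fold (conjg L) v ` A = A" if "A = Q" "v \<in> lists (pnormalizer L Q)" for A v
    using that(2)
  proof (induction v)
    case Nil
    then show ?case
      using that(1) assms(1) by simp
  next
    case (Cons g v)
    then have g: "Q \<subseteq> conj_dom L g" "conjg L g ` Q = Q"
      by (auto simp: pnormalizer_def)
    have "fold (conjg L) (g # v) ` Q = fold (conjg L) v ` conjg L g ` Q"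
      by (simp add: image_image)
    then show ?case
      using Cons.IH g assms(1) that(1) by (auto simp: S_word_Cons S_elt_def)
  qed
  then have Qv: "Q \<subseteq> S_word L S v" "fold (conjg L) v ` Q = Q"
    using v by auto
  have path: "path (S_word L S v) v (fold (conjg L) v ` S_word L S v)"
    using Dom_S_word v by blast
  have "v \<in> lists (elts L)"
    using Dom_elts v by blast
  then have "Q \<subseteq> pnormalizer L (S_word L S v)"
    using Qv(1) subset_normalizer[OF S_word_pg finite_subset[OF S_word_subset finite_S]] by blast
  then have y: "y \<in> conj_dom L (pprod L v)" "conjg L (pprod L v) y = fold (conjg L) v y" if "y \<in> Q" for y
    using conj_by_word(1)[OF path_conj_Dom[OF path]] conj_prod_fold[OF path] that by blast+
  have "pprod L v \<in> elts L"
    using v prod_closed by blast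
  moreover have "conjg L (pprod L v) ` Q = Q"
    using y(2) Qv(2) by simp
  ultimately show "pprod L v \<in> pnormalizer L Q"
    using y(1) by (auto simp: pnormalizer_def)
qed

text \<open>All objects lie in \<open>S\<close> and hence in \<open>H\<close>, so chains of objects
  along words over \<open>H\<close> are the same in both partial groups. Maximality of
  \<open>S\<close> is inherited because p-subgroups of \<open>H\<close> are p-subgroups of
  \<open>L\<close>.\<close>

lemma locality_sub_pgroup:
  assumes "partial_subgroup L H" "S \<subseteq> H"
  shows "locality (sub_pgroup L H) p \<Delta> S"
proof -
  have H: "H \<subseteq> elts L" "\<And>h. h \<in> H \<Longrightarrow> pinv L h \<in> H"
    using assms(1) by (auto simp: partial_subgroup_def)
  have "H \<noteq> {}"
    using assms(2) pg_subgroupD(4)[OF S_pg] by blast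
  then interpret H: partial_group "sub_pgroup L H"
    using partial_group_sub_pgroup[OF partial_group_axioms assms(1)] by blast
  have dom: "P \<subseteq> conj_dom (sub_pgroup L H) f \<longleftrightarrow> P \<subseteq> conj_dom L f" if "f \<in> H" "P \<in> \<Delta>" for P f
    using conj_dom_sub_pgroup[OF that(1) H(2,1)] DeltaD(1)[OF that(2)] assms(2) by blast
  show ?thesis
  proof (intro locality.intro locality_axioms.intro)
    show "partial_group (sub_pgroup L H)"
      by (rule H.partial_group_axioms)
    show "prime p" "\<Delta> \<noteq> {}"
      using prime_p Delta_nonempty .
    show "finite (elts (sub_pgroup L H))"
      using H(1) finite_elts finite_subset by auto
    show "p_subgroup p (sub_pgroup L H) S"
      using p_subgroup_sub_pgroup[OF H(1)] assms(2) S_p_subgroup by blast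
    show "T = S" if "p_subgroup p (sub_pgroup L H) T" "S \<subseteq> T" for T
      using p_subgroup_sub_pgroup[OF H(1)] that L1 by blast
    show "subgroup P (grp (sub_pgroup L H) S)" if "P \<in> \<Delta>" for P
      using Delta_subgroups[OF that] by simp
    show "w \<in> Dom (sub_pgroup L H) \<longleftrightarrow>
      (\<exists>P :: nat \<Rightarrow> 'a set. (\<forall>i\<le>length w. P i \<in> \<Delta>) \<and>
        (\<forall>i<length w. P i \<subseteq> conj_dom (sub_pgroup L H) (w ! i) \<and>
          conjg (sub_pgroup L H) (w ! i) ` P i = P (Suc i)))"
      if "w \<in> lists (elts (sub_pgroup L H))" for w
    proof -
      have w: "w \<in> lists H" "w \<in> lists (elts L)"
        using that H(1) by auto
      have wi: "w ! i \<in> H" if "i < length w" for i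
        using w(1) that by auto
      have "w \<in> Dom (sub_pgroup L H) \<longleftrightarrow> w \<in> Dom L"
        using w(1) by simp
      also have "\<dots> \<longleftrightarrow> (\<exists>P :: nat \<Rightarrow> 'a set. (\<forall>i\<le>length w. P i \<in> \<Delta>) \<and>
        (\<forall>i<length w. P i \<subseteq> conj_dom L (w ! i) \<and> conjg L (w ! i) ` P i = P (Suc i)))"
        by (rule L2[OF w(2)])
      also have "\<dots> \<longleftrightarrow> (\<exists>P :: nat \<Rightarrow> 'a set. (\<forall>i\<le>length w. P i \<in> \<Delta>) \<and>
        (\<forall>i<length w. P i \<subseteq> conj_dom (sub_pgroup L H) (w ! i) \<and>
          conjg (sub_pgroup L H) (w ! i) ` P i = P (Suc i)))"
        using dom wi by (intro ex_cong conj_cong refl) auto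
      finally show ?thesis .
    qed
    show "conjg (sub_pgroup L H) f ` P \<in> \<Delta>"
      if "P \<in> \<Delta>" "f \<in> elts (sub_pgroup L H)" "P \<subseteq> conj_dom (sub_pgroup L H) f"
        "subgroup (conjg (sub_pgroup L H) f ` P) (grp (sub_pgroup L H) S)" for P f
      using L3_conj[OF that(1)] that(2-4) dom[OF _ that(1)] H(1) by auto
    show "R \<in> \<Delta>" if "P \<in> \<Delta>" "subgroup R (grp (sub_pgroup L H) S)" "P \<subseteq> R" for P R
      using L3_over[OF that(1)] that(2,3) by simp
  qed
qed

lemma S_word_sub_pgroup:
  assumes "partial_subgroup L H" "S \<subseteq> H" "w \<in> lists H"
  shows "S_word (sub_pgroup L H) S w = S_word L S w"
  using assms(3)
proof (induction w)
  case (Cons g w)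
  have "S_elt (sub_pgroup L H) S g = S_elt L S g"
    using conj_dom_sub_pgroup[of g H L] Cons.hyps assms(1,2)
    by (auto simp: S_elt_def partial_subgroup_def)
  then show ?case
    using Cons.IH by (simp add: S_word_Cons)
qed simp

text \<open>A letter that keeps \<open>Q\<close> inside \<open>S\<close> fixes \<open>Q\<close>, so
  the next letter starts from \<open>Q\<close> again.\<close>

lemma weakly_closed_word:
  assumes "weakly_closed L S Q" "w \<in> lists (elts L)" "Q \<subseteq> S_word L S w"
  shows "w \<in> lists (pnormalizer L Q)"
  using assms(2,3)
proof (induction w)
  case (Cons g w)
  have Q: "Q \<subseteq> S_elt L S g" "conjg L g ` Q \<subseteq> S_word L S w"
    using Cons.prems by (auto simp: S_word_Cons)
  then have "conjg L g ` Q = Q"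
    using assms(1) Cons.hyps by (simp add: weakly_closed_def)
  moreover have "Q \<subseteq> conj_dom L g"
    using Q(1) by (auto simp: S_elt_def)
  ultimately show ?case
    using Cons Q(2) by (simp add: pnormalizer_def)
qed simp

text \<open>A morphism of the normalizer extends to a product with \<open>Q\<close>; the word
  inducing the extension has \<open>Q\<close> in its domain, so weak closure places its letters in
  the normalizer of \<open>Q\<close>. Conversely, a word over that normalizer is defined on
  \<open>Q\<close> and fixes it, so it extends any of its restrictions.\<close>

lemma normalizer_fusion_system_eq:
  assumes Q: "Q \<lhd> grp L S" and wc: "weakly_closed L S Q"
  shows "normalizer_fusion_system (grp L S) (fusion_system_of L S) Q =
    fusion_system_of (pnormalizer_pgroup L Q) S"
proof -
  interpret group "grp L S"
    using S_pg by (rule group_grp)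
  interpret Q: normal Q "grp L S"
    by fact
  have Qpg: "Q \<subseteq> S" "pg_subgroup L Q"
    using Q.subgroup_axioms S_pg by (simp_all add: subgroup_grp_iff)
  let ?H = "pnormalizer L Q"
  have "s \<in> ?H" if s: "s \<in> S" for s
  proof -
    have "conjg L s x \<in> Q" if x: "x \<in> Q" for x
    proof -
      have "s \<in> carrier (grp L S)" "x \<in> S"
        using s x Qpg(1) by auto
      then show ?thesis
        using Q.inv_op_closed1[of s x] conj_grp(2)[OF S_pg s, of x] x by presburger
    qed
    then show ?thesis
      using mem_normalizer_in_group_iff[OF S_pg s Qpg(1)] finite_subset[OF Qpg(1) finite_S] by blast
  qed
  then have SH: "S \<subseteq> ?H"
    by blast
  have psub: "partial_subgroup L ?H"
    using normalizer_partial_subgroup[OF Qpg(1) SH] .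
  then have HL: "?H \<subseteq> elts L"
    by (simp add: partial_subgroup_def)
  interpret H: locality "sub_pgroup L ?H" p \<Delta> S
    using locality_sub_pgroup[OF psub SH] .
  \<comment> \<open>Reduces the subgroup conditions in \<open>normalizer_fusion_system\<close> to
    being a subgroup of \<open>S\<close>.\<close>
  have normS: "normalizer (grp L S) Q = S"
  proof -
    have "s <#\<^bsub>grp L S\<^esub> Q #>\<^bsub>grp L S\<^esub> inv\<^bsub>grp L S\<^esub> s = Q" if "s \<in> carrier (grp L S)" for s
      using that Q.coset_eq Q.subset coset_mult_assoc[of Q s "inv\<^bsub>grp L S\<^esub> s"] coset_mult_one[OF Q.subset]
      by (metis inv_closed r_inv)
    then show ?thesis
      using Q.subset by (auto simp: normalizer_def stabilizer_def)
  qed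
  have prod_sub: "subgroup (X <#>\<^bsub>grp L S\<^esub> Q) (grp L S)" "X \<subseteq> X <#>\<^bsub>grp L S\<^esub> Q" "Q \<subseteq> X <#>\<^bsub>grp L S\<^esub> Q"
    if X: "subgroup X (grp L S)" for X
  proof -
    interpret XQ: second_isomorphism_grp Q "grp L S" X
      using X by (intro second_isomorphism_grp.intro second_isomorphism_grp_axioms.intro Q)
    \<comment> \<open>The second isomorphism locale has the normal factor on the left, the fusion
      system on the right.\<close>
    have eq: "X <#>\<^bsub>grp L S\<^esub> Q = Q <#>\<^bsub>grp L S\<^esub> X"
      using commut_normal[OF X Q] .
    show "subgroup (X <#>\<^bsub>grp L S\<^esub> Q) (grp L S)" "X \<subseteq> X <#>\<^bsub>grp L S\<^esub> Q" "Q \<subseteq> X <#>\<^bsub>grp L S\<^esub> Q"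
      unfolding eq using XQ.normal_set_mult_subgroup XQ.S_contained_in_set_mult XQ.H_contained_in_set_mult .
  qed
  have word: "S_word (sub_pgroup L ?H) S w = S_word L S w" if "w \<in> lists ?H" for w
    using S_word_sub_pgroup[OF psub SH that] .
  have "normalizer_fusion_system (grp L S) word_homs Q X Y = H.word_homs X Y" for X Y
  proof (intro equalityI subsetI)
    fix \<phi> assume "\<phi> \<in> normalizer_fusion_system (grp L S) word_homs Q X Y"
    then obtain \<phi>' where \<phi>: "\<phi> \<in> word_homs X Y" "\<phi>' \<in> word_homs (X <#>\<^bsub>grp L S\<^esub> Q) (Y <#>\<^bsub>grp L S\<^esub> Q)"
      "\<forall>x\<in>X. \<phi>' x = \<phi> x"
      by (auto simp: normalizer_fusion_system_def)
    obtain u where u: "\<phi> = restrict (fold (conjg L) u) X" "subgroup X (grp L S)" "subgroup Y (grp L S)"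
      "fold (conjg L) u ` X \<subseteq> Y"
      using \<phi>(1) by (rule word_homsE)
    obtain w where w: "\<phi>' = restrict (fold (conjg L) w) (X <#>\<^bsub>grp L S\<^esub> Q)" "w \<in> lists (elts L)"
      "X <#>\<^bsub>grp L S\<^esub> Q \<subseteq> S_word L S w"
      using \<phi>(2) by (rule word_homsE)
    have wH: "w \<in> lists ?H"
      using weakly_closed_word[OF wc w(2)] prod_sub(3)[OF u(2)] w(3) by blast
    \<comment> \<open>The word \<open>u\<close> for the morphism itself may leave the normalizer of
      \<open>Q\<close>; it is replaced by the word \<open>w\<close> of the extension, which has the
      same effect on \<open>X\<close>.\<close>
    have agree: "fold (conjg L) w x = fold (conjg L) u x" if "x \<in> X" for x
    proof -
      have "x \<in> X <#>\<^bsub>grp L S\<^esub> Q" "\<phi>' x = \<phi> x"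
        using prod_sub(2)[OF u(2)] \<phi>(3) that by blast+
      then show ?thesis
        using that by (simp add: u(1) w(1))
    qed
    have eq: "\<phi> = restrict (fold (conjg L) w) X"
      unfolding u(1) using agree by (intro restrict_ext) simp
    have "restrict (fold (conjg (sub_pgroup L ?H)) w) X \<in> H.word_homs X Y"
    proof (rule H.word_homsI)
      show "w \<in> lists (elts (sub_pgroup L ?H))"
        using wH by simp
      show "X \<subseteq> S_word (sub_pgroup L ?H) S w"
        using word[OF wH] prod_sub(2)[OF u(2)] w(3) by blast
      show "fold (conjg (sub_pgroup L ?H)) w ` X \<subseteq> Y"
        using u(4) agree by (simp add: image_subset_iff)
    qed (use u in simp_all)
    then show "\<phi> \<in> H.word_homs X Y"
      by (simp only: eq sub_pgroup_simps)
  next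
    fix \<phi> assume "\<phi> \<in> H.word_homs X Y"
    then obtain w where "\<phi> = restrict (fold (conjg (sub_pgroup L ?H)) w) X"
      "w \<in> lists (elts (sub_pgroup L ?H))" "X \<subseteq> S_word (sub_pgroup L ?H) S w"
      "subgroup X (grp (sub_pgroup L ?H) S)" "subgroup Y (grp (sub_pgroup L ?H) S)"
      "fold (conjg (sub_pgroup L ?H)) w ` X \<subseteq> Y"
      by (rule H.word_homsE)
    then have w: "\<phi> = restrict (fold (conjg L) w) X" "w \<in> lists ?H" "X \<subseteq> S_word L S w"
      "subgroup X (grp L S)" "subgroup Y (grp L S)" "fold (conjg L) w ` X \<subseteq> Y"
      using word by (simp_all only: sub_pgroup_simps)
    have wL: "w \<in> lists (elts L)"
      using w(2) lists_mono[OF HL] by blast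
    have "Q \<subseteq> S_word L S w \<and> fold (conjg L) w ` Q = Q"
      using w(2)
    proof (induction w)
      case Nil
      then show ?case
        using Qpg(1) by simp
    next
      case (Cons g w)
      then have g: "Q \<subseteq> conj_dom L g" "conjg L g ` Q = Q"
        by (auto simp: pnormalizer_def)
      have "fold (conjg L) (g # w) ` Q = fold (conjg L) w ` conjg L g ` Q"
        by (simp add: image_image)
      then show ?case
        using Cons.IH g Qpg(1) by (auto simp: S_word_Cons S_elt_def)
    qed
    then have Qw: "Q \<subseteq> S_word L S w" "fold (conjg L) w ` Q = Q"
      by auto
    have "fold (conjg L) w z \<in> Y <#>\<^bsub>grp L S\<^esub> Q \<and> z \<in> S_word L S w" if z: "z \<in> X <#>\<^bsub>grp L S\<^esub> Q" for z
    proof -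
      obtain x q where xq: "x \<in> X" "q \<in> Q" "z = pprod L [x, q]"
        using z by (auto simp: set_mult_def)
      have "fold (conjg L) w z = pprod L [fold (conjg L) w x, fold (conjg L) w q]" "z \<in> S_word L S w"
        using S_word_mult[OF wL, of x q] xq w(3) Qw(1) by auto
      moreover have "fold (conjg L) w x \<in> Y" "fold (conjg L) w q \<in> Q"
        using xq w(6) Qw(2) by auto
      ultimately show ?thesis
        by (auto simp: set_mult_def)
    qed
    then have "restrict (fold (conjg L) w) (X <#>\<^bsub>grp L S\<^esub> Q) \<in> word_homs (X <#>\<^bsub>grp L S\<^esub> Q) (Y <#>\<^bsub>grp L S\<^esub> Q)"
      using prod_sub(1) w(4,5) wL by (intro word_homsI) blast+
    moreover have "\<forall>x\<in>X. restrict (fold (conjg L) w) (X <#>\<^bsub>grp L S\<^esub> Q) x = \<phi> x"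
      using prod_sub(2)[OF w(4)] by (auto simp: w(1))
    moreover have "restrict (fold (conjg L) w) (X <#>\<^bsub>grp L S\<^esub> Q) ` Q = Q"
      using prod_sub(3)[OF w(4)] Qw(2) by (simp add: subset_iff image_def)
    moreover have "\<phi> \<in> word_homs X Y"
      unfolding w(1) using w wL by (intro word_homsI)
    ultimately show "\<phi> \<in> normalizer_fusion_system (grp L S) word_homs Q X Y"
      using w(4,5) unfolding normalizer_fusion_system_def normS grp_simps by blast
  qed
  then show ?thesis
    unfolding pnormalizer_pgroup_def fusion_system_of_eq H.fusion_system_of_eq by blast
qed

section \<open>Overgroups of large subgroups\<close>

lemma large_overgroup:
  assumes "large L S Q" "pg_subgroup L R" "Q \<subseteq> R" "R \<subseteq> S"
  shows "pcentralizer L R \<subseteq> R" "group_center L R \<subseteq> group_center L Q"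
proof -
  have "pcentralizer L R \<subseteq> pcentralizer L Q"
    using assms(3) by (auto simp: pcentralizer_def)
  then show "pcentralizer L R \<subseteq> R"
    using largeD(4)[OF assms(1)] assms(3) by blast
  show "group_center L R \<subseteq> group_center L Q"
  proof
    fix z assume "z \<in> group_center L R"
    then have z: "z \<in> R" "\<And>x. x \<in> R \<Longrightarrow> pprod L [z, x] = pprod L [x, z]"
      unfolding group_center_def by blast+
    have comm: "pprod L [x, z] = pprod L [z, x]" if "x \<in> Q" for x
      using z(2)[of x] assms(3) that by auto
    have "z \<in> Q"
      using large_contains_commuting[OF assms(1) S_pg largeD(1)[OF assms(1)] _ comm] z(1) assms(4) by blast
    then show "z \<in> group_center L Q"
      using comm[symmetric] unfolding group_center_def by blast
  qed
qed

text \<open>A subgroup of the centre of the product lies in the centres of both factors, so its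
  normalizer normalizes both \<open>Q\<close> and \<open>R\<close>, and hence their product.\<close>

lemma large_mult:
  assumes Q: "large L S Q" and R: "large L S R"
  shows "large L S (Q <#>\<^bsub>grp L S\<^esub> R)"
proof -
  interpret group "grp L S"
    using S_pg by (rule group_grp)
  let ?QR = "Q <#>\<^bsub>grp L S\<^esub> R"
  have subs: "subgroup Q (grp L S)" "subgroup R (grp L S)"
    using largeD(1,2)[OF Q] largeD(1,2)[OF R] S_pg by (simp_all add: subgroup_grp_iff)
  interpret normal Q "grp L S"
    using Q by (rule large_normal)
  interpret QR: second_isomorphism_grp Q "grp L S" R
    using subs(2) by (intro second_isomorphism_grp.intro second_isomorphism_grp_axioms.intro normal_axioms)
  have QR: "pg_subgroup L ?QR" "?QR \<subseteq> S"
    using QR.normal_set_mult_subgroup S_pg by (simp_all add: subgroup_grp_iff)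
  note QQR = QR.H_contained_in_set_mult and RQR = QR.S_contained_in_set_mult
  have "pnormalizer L Q \<inter> pnormalizer L R \<subseteq> pnormalizer L ?QR"
  proof
    fix f assume "f \<in> pnormalizer L Q \<inter> pnormalizer L R"
    then have f: "f \<in> elts L" "Q \<subseteq> conj_dom L f" "conjg L f ` Q = Q" "R \<subseteq> conj_dom L f" "conjg L f ` R = R"
      by (auto simp: pnormalizer_def)
    \<comment> \<open>Both factors lie in the group \<open>S_elt L S f\<close>, on which conjugation
      by \<open>f\<close> is multiplicative.\<close>
    then have Sf: "Q \<subseteq> S_elt L S f" "R \<subseteq> S_elt L S f"
      using largeD(1)[OF Q] largeD(1)[OF R] by (auto simp: S_elt_def)
    have "z \<in> conj_dom L f \<and> conjg L f z \<in> ?QR" if z: "z \<in> ?QR" for z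
    proof -
      obtain x y where xy: "x \<in> Q" "y \<in> R" "z = pprod L [x, y]"
        using z by (auto simp: set_mult_def)
      have "z \<in> S_elt L S f" "conjg L f z = pprod L [conjg L f x, conjg L f y]"
        using S_elt_mult[OF f(1), of x y] Sf xy by auto
      moreover have "conjg L f x \<in> Q" "conjg L f y \<in> R"
        using f xy by auto
      ultimately show ?thesis
        by (auto simp: set_mult_def S_elt_def)
    qed
    then show "f \<in> pnormalizer L ?QR"
      using finite_subset[OF QR(2) finite_S] by (intro normalizer_mem_finite[OF f(1)]) blast+
  qed
  then show ?thesis
    using largeI[OF QR(2,1) large_overgroup(1)[OF Q QR(1) QQR QR(2)]]
      largeD(5)[OF Q] largeD(5)[OF R] large_overgroup(2)[OF Q QR(1) QQR QR(2)]
      large_overgroup(2)[OF R QR(1) RQR QR(2)] by (metis Int_greatest subset_trans)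
qed

text \<open>\<open>Q\<close> is itself normalized by all of its normalizer, so maximality gives
  \<open>Q \<subseteq> P\<close>. Whatever normalizes a nontrivial subgroup of the centre of
  \<open>P\<close> then normalizes \<open>Q\<close>, and so it normalizes \<open>P\<close>.\<close>

lemma large_largest_normal:
  assumes Q: "large L S Q" and P: "largest_normal (pnormalizer_pgroup L Q) S P"
  shows "large L S P"
proof -
  let ?H = "pnormalizer L Q"
  have SH: "S \<subseteq> ?H"
    using S_normalizes_large[OF Q] .
  have psub: "partial_subgroup L ?H"
    using normalizer_partial_subgroup[OF largeD(1)[OF Q] SH] .
  then have H: "\<And>h. h \<in> ?H \<Longrightarrow> pinv L h \<in> ?H" "?H \<subseteq> elts L"
    by (auto simp: partial_subgroup_def)
  have PS: "P \<subseteq> S" "pg_subgroup L P" and norm: "pnormalizer (sub_pgroup L ?H) P = ?H"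
    using P S_pg by (simp_all add: largest_normal_def pnormalizer_pgroup_def subgroup_grp_iff)
  have "pnormalizer (sub_pgroup L ?H) Q = ?H"
  proof -
    have "Q \<subseteq> conj_dom (sub_pgroup L ?H) f" "conjg L f ` Q = Q" if "f \<in> ?H" for f
      using that conj_dom_sub_pgroup[OF that H] largeD(1)[OF Q] SH by (auto simp: pnormalizer_def)
    then show ?thesis
      unfolding pnormalizer_def[of "sub_pgroup L ?H"] sub_pgroup_simps by blast
  qed
  moreover have "subgroup Q (grp L S)"
    using Q by (simp add: large_def)
  ultimately have QP: "Q \<subseteq> P"
    using P by (simp add: largest_normal_def pnormalizer_pgroup_def)
  have "?H \<subseteq> pnormalizer L P"
  proof
    fix f assume f: "f \<in> ?H"
    then have "P \<subseteq> conj_dom (sub_pgroup L ?H) f" "conjg L f ` P = P"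
      using norm unfolding pnormalizer_def[of "sub_pgroup L ?H"] sub_pgroup_simps by blast+
    then show "f \<in> pnormalizer L P"
      using f H(2) conj_dom_sub_pgroup[OF f H] by (auto simp: pnormalizer_def[of L P])
  qed
  then show ?thesis
    using largeI[OF PS large_overgroup(1)[OF Q PS(2) QP PS(1)]]
      largeD(5)[OF Q] large_overgroup(2)[OF Q PS(2) QP PS(1)] by (metis subset_trans)
qed

end

theorem lemma4p6:
  fixes p :: nat and L :: "'a pgroup" and \<Delta> :: "'a set set" and S Q :: "'a set"
    and F :: "'a homsets"
  assumes "locality_over p L \<Delta> S F"
    and "large L S Q"
  shows "(weakly_closed L S Q \<and>
      Q \<lhd> grp L S \<and>
      locality_over p (pnormalizer_pgroup L Q) \<Delta> S (normalizer_fusion_system (grp L S) F Q) \<and>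
      largest_normal (pnormalizer_pgroup L Q) S (O_p (pnormalizer_pgroup L Q) S)) \<and>
    large L S (O_p (pnormalizer_pgroup L Q) S) \<and>
    (\<forall>R. large L S R \<longrightarrow> large L S (Q <#>\<^bsub>grp L S\<^esub> R))"
proof -
  interpret locality L p \<Delta> S
    using assms(1) by (simp add: locality_over_def)
  have F: "F = fusion_system_of L S"
    using assms(1) by (simp add: locality_over_def)
  note wc = large_weakly_closed[OF assms(2)] and normal = large_normal[OF assms(2)]
  have loc: "locality (pnormalizer_pgroup L Q) p \<Delta> S"
    unfolding pnormalizer_pgroup_def
    using S_normalizes_large[OF assms(2)] largeD(1)[OF assms(2)]
    by (intro locality_sub_pgroup normalizer_partial_subgroup)
  then have O_p: "largest_normal (pnormalizer_pgroup L Q) S (O_p (pnormalizer_pgroup L Q) S)"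
    by (rule locality.O_p_largest_normal)
  show ?thesis
    using wc normal loc O_p normalizer_fusion_system_eq[OF normal wc]
      large_largest_normal[OF assms(2) O_p] large_mult[OF assms(2)]
    by (simp add: locality_over_def F)
qed

end
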